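(* Let $n\ge 2$ and let $K_n$ be the complete graph on $n$ vertices. Fix any total ordering of $E(K_n)$ and any field $\Bbbk$. Then $$h_{K_n}(z)=\prod_{j=1}^{n-2}(1+jz),\qquad \mathrm{Hilb}(\Bbbk[\mathrm{BC}(K_n)];z)=\frac{\prod_{j=1}^{n-2}(1+jz)}{(1-z)^{n-1}}.$$ In particular, writing $h_{K_n}(z)=\sum_i h_i z^i$, one has $$h_i=\left[{n-1\atop n-1-i}\right]\qquad(0\le i\le n-2),$$ an unsigned Stirling number of the first kind.
   Context: Empty products equal $1$. The unsigned Stirling number of the first kind $\left[{a\atop b}\right]$ is the number of permutations of $a$ elements with exactly $b$ cycles. For a finite connected loopless graph $G$ with a fixed total order on $E(G)$, a broken circuit is a set $C\setminus\{\max C\}$, where $C$ is the edge set of a cycle of $G$ and $\max C$ is its largest edge. The broken-circuit complex $\mathrm{BC}(G)$ is the simplicial complex on $E(G)$ whose faces are the edge sets containing no broken circuit. Its Stanley--Reisner ring is $\Bbbk[\mathrm{BC}(G)]=\Bbbk[x_e:e\in E(G)]/I_{\mathrm{BC}(G)}$, with $I_{\mathrm{BC}(G)}$ generated by the monomials $\prod_{e\in C\setminus\{\max C\}}x_e$ over all cycles $C$ of $G$; it is graded by $\deg x_e=1$, and $\mathrm{Hilb}$ denotes its Hilbert series. With $r=|V(G)|-1$ and $b_i$ the number of faces of $\mathrm{BC}(G)$ having exactly $i$ elements, the $h$-polynomial of $\mathrm{BC}(G)$ is $h_G(z)=\sum_{i=0}^{r}b_i z^i(1-z)^{r-i}$.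 *)

theory Defs
  imports
    "HOL-Algebra.QuotRing"
    "HOL-Algebra.Embedded_Algebras"
    "HOL-Library.Poly_Mapping"
    "HOL-Computational_Algebra.Polynomial"
    "HOL-Computational_Algebra.Formal_Power_Series"
    "HOL-Combinatorics.Permutations"
    "HOL-Combinatorics.Orbits"
begin

section \<open>Graphs and broken circuits\<close>

text \<open>Parallel edges are allowed: an edge \<open>e\<close> is an abstract object whose set of endpoints is
  \<open>ends G e\<close>.\<close>

record ('v, 'e) graph =
  verts :: "'v set"
  edges :: "'e set"
  ends :: "'e \<Rightarrow> 'v set"

definition complete_graph :: "'v set \<Rightarrow> ('v, 'v set) graph" where
  "complete_graph V = \<lparr>verts = V, edges = {e. e \<subseteq> V \<and> card e = 2}, ends = (\<lambda>e. e)\<rparr>"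

text \<open>A cycle visits pairwise distinct vertices \<open>vs ! 0, vs ! 1, \<dots>\<close> along pairwise distinct
  edges and returns to \<open>vs ! 0\<close>. Its length is at least 2, and it is 2 exactly for a pair of
  parallel edges; in a simple graph every cycle therefore has length at least 3.\<close>

definition cycle_edge_set :: "('v, 'e) graph \<Rightarrow> 'e set \<Rightarrow> bool" where
  "cycle_edge_set G C \<longleftrightarrow>
    (\<exists>vs es. length vs = length es \<and> 2 \<le> length es \<and> distinct vs \<and> distinct es \<and>
      set vs \<subseteq> verts G \<and> set es \<subseteq> edges G \<and>
      (\<forall>i<length es. ends G (es ! i) = {vs ! i, vs ! (Suc i mod length vs)}) \<and>
      C = set es)"

text \<open>The order on the edges is a relation \<open>ord\<close> in which \<open>(e, f) \<in> ord\<close> means \<open>e \<le> f\<close>.\<close>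

definition broken_circuit :: "('v, 'e) graph \<Rightarrow> ('e \<times> 'e) set \<Rightarrow> 'e set \<Rightarrow> bool" where
  "broken_circuit G ord B \<longleftrightarrow>
    (\<exists>C m. cycle_edge_set G C \<and> m \<in> C \<and> (\<forall>c\<in>C. (c, m) \<in> ord) \<and> B = C - {m})"

definition broken_circuit_complex :: "('v, 'e) graph \<Rightarrow> ('e \<times> 'e) set \<Rightarrow> 'e set set" where
  "broken_circuit_complex G ord =
    {F. F \<subseteq> edges G \<and> (\<nexists>B. broken_circuit G ord B \<and> B \<subseteq> F)}"

definition face_number :: "('v, 'e) graph \<Rightarrow> ('e \<times> 'e) set \<Rightarrow> nat \<Rightarrow> nat" where
  "face_number G ord i = card {F \<in> broken_circuit_complex G ord. card F = i}"

definition h_polynomial :: "('v, 'e) graph \<Rightarrow> ('e \<times> 'e) set \<Rightarrow> int poly" where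
  "h_polynomial G ord = (let r = card (verts G) - 1 in
    \<Sum>i=0..r. of_nat (face_number G ord i) * [:0, 1:] ^ i * [:1, -1:] ^ (r - i))"


section \<open>The Stanley--Reisner ring of the broken-circuit complex\<close>

text \<open>A monomial is a finitely supported exponent function \<open>'e \<Rightarrow>\<^sub>0 nat\<close>, and a polynomial is a
  finitely supported function from monomials to coefficients. The type provides one variable for
  every element of \<open>'e\<close>; \<open>poly_ring E\<close> only admits the variables indexed by \<open>E\<close>.\<close>

type_synonym ('e, 'k) mpoly = "('e \<Rightarrow>\<^sub>0 nat) \<Rightarrow>\<^sub>0 'k"

definition const :: "'k \<Rightarrow> ('e, 'k::field) mpoly" where
  "const c = Poly_Mapping.single 0 c"

definition var :: "'e \<Rightarrow> ('e, 'k::field) mpoly" where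
  "var e = Poly_Mapping.single (Poly_Mapping.single e 1) 1"

definition monomial_degree :: "('e \<Rightarrow>\<^sub>0 nat) \<Rightarrow> nat" where
  "monomial_degree m = (\<Sum>e\<in>Poly_Mapping.keys m. Poly_Mapping.lookup m e)"

definition poly_ring :: "'e set \<Rightarrow> ('e, 'k::field) mpoly ring" where
  "poly_ring E =
    \<lparr>carrier = {p. \<forall>m\<in>Poly_Mapping.keys p. Poly_Mapping.keys m \<subseteq> E},
     monoid.mult = (*), one = 1, zero = 0, add = (+)\<rparr>"

definition homogeneous_part :: "'e set \<Rightarrow> nat \<Rightarrow> ('e, 'k::field) mpoly set" where
  "homogeneous_part E d =
    {p \<in> carrier (poly_ring E). \<forall>m\<in>Poly_Mapping.keys p. monomial_degree m = d}"

definition bc_ideal :: "('v, 'e) graph \<Rightarrow> ('e \<times> 'e) set \<Rightarrow> ('e, 'k::field) mpoly set" where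
  "bc_ideal G ord =
    Idl\<^bsub>poly_ring (edges G)\<^esub> {\<Prod>e\<in>B. var e | B. broken_circuit G ord B}"

definition bc_ring :: "('v, 'e) graph \<Rightarrow> ('e \<times> 'e) set \<Rightarrow> ('e, 'k::field) mpoly set ring" where
  "bc_ring G ord = poly_ring (edges G) Quot bc_ideal G ord"

definition bc_proj ::
  "('v, 'e) graph \<Rightarrow> ('e \<times> 'e) set \<Rightarrow> ('e, 'k::field) mpoly \<Rightarrow> ('e, 'k) mpoly set" where
  "bc_proj G ord p = bc_ideal G ord +>\<^bsub>poly_ring (edges G)\<^esub> p"

text \<open>The field acts on the quotient through its copy \<open>bc_scalars\<close> inside the quotient, as
  required by \<^const>\<open>ring.dim\<close>, which measures dimension over a subfield of the ring.\<close>

definition bc_scalars :: "('v, 'e) graph \<Rightarrow> ('e \<times> 'e) set \<Rightarrow> ('e, 'k::field) mpoly set set" where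
  "bc_scalars G ord = bc_proj G ord ` const ` UNIV"

definition bc_component ::
  "('v, 'e) graph \<Rightarrow> ('e \<times> 'e) set \<Rightarrow> nat \<Rightarrow> ('e, 'k::field) mpoly set set" where
  "bc_component G ord d = bc_proj G ord ` homogeneous_part (edges G) d"

text \<open>The coefficients are natural numbers; they are embedded into the rationals so that the
  series can be compared with a quotient of power series.\<close>

definition bc_hilbert_series ::
  "'k::field itself \<Rightarrow> ('v, 'e) graph \<Rightarrow> ('e \<times> 'e) set \<Rightarrow> rat fps" where
  "bc_hilbert_series _ G ord =
    Abs_fps (\<lambda>d. of_nat (ring.dim (bc_ring G ord :: ('e, 'k) mpoly set ring)
      (bc_scalars G ord) (bc_component G ord d)))"


section \<open>Unsigned Stirling numbers of the first kind\<close>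

text \<open>Cycles are counted as orbits, so a fixed point counts as a cycle of length 1.\<close>

definition stirling_first :: "nat \<Rightarrow> nat \<Rightarrow> nat" where
  "stirling_first a b = card {p. p permutes {..<a} \<and> card (orbit p ` {..<a}) = b}"

end

theory Submission
  imports Defs
    "HOL-Library.Transitive_Closure_Table"
    "HOL-Combinatorics.Stirling"
    "HOL-Computational_Algebra.Polynomial_FPS"
begin

text \<open>For a colouring of the vertices, the monochromatic edges form a flat, and toggling the
  largest edge of a nonempty flat shows that its broken-circuit-free subsets of even and of odd size
  are equally many. The edges of a forest \<open>F\<close> are all monochromatic for exactly
  \<open>q ^ (|V| - |F|)\<close> of the colourings with \<open>q\<close> colours, so summing over all colourings gives
  Whitney's expression of the chromatic polynomial. For the complete graph this polynomial is
  \<open>q (q - 1) \<dots> (q - n + 1)\<close>, which determines the face numbers whatever the edge order. The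
  residues of the monomials whose support is a face form a basis of the Stanley--Reisner ring, so
  each face \<open>F\<close> contributes \<open>(z / (1 - z)) ^ |F|\<close> to the Hilbert series.\<close>


section \<open>Monochromatic edges and forests\<close>

text \<open>The h-polynomial and the numerator of the Hilbert series are the same sum of z^|F| (1 -
  z)^(n - 1 - |F|) over the faces F, so a single polynomial identity settles both. Colour counts
  control this sum only at special points: q colours correspond to z / (1 - z) = -1 / q, that is, to
  z = -1 / (q - 1). The comparison is made for all q > n, and these infinitely many points identify
  the polynomial. Since the points are fractions, the identity is proved over the rationals and then
  carried over to integer polynomials and to power series.\<close>

definition monochromatic :: "('v, 'e) graph \<Rightarrow> ('v \<Rightarrow> 'c) \<Rightarrow> 'e \<Rightarrow> bool" where
  "monochromatic G f e \<longleftrightarrow> (\<forall>x\<in>ends G e. \<forall>y\<in>ends G e. f x = f y)"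

definition colorings :: "('v, 'e) graph \<Rightarrow> nat \<Rightarrow> 'e set \<Rightarrow> ('v \<Rightarrow> nat) set" where
  "colorings G q F = {f \<in> verts G \<rightarrow>\<^sub>E {..<q}. \<forall>e\<in>F. monochromatic G f e}"

text \<open>Evaluates sums of two residues by at most one subtraction; it serves both the
  wrap-around of cycle indices and the rotation of colours.\<close>

lemma mod_less_double:
  "a < 2 * n \<Longrightarrow> a mod n = (if a < n then a else a - n)" for a n :: nat
  by (simp add: mod_if[of a n])

text \<open>Going round the cycle from one end of \<open>m\<close> to the other along the remaining
  edges never changes the colour. This is why the monochromatic edges form a flat.\<close>

lemma cycle_edge_set_monochromatic:
  assumes C: "cycle_edge_set G C" and m: "m \<in> C"
    and mono: "\<And>e. e \<in> C - {m} \<Longrightarrow> monochromatic G f e"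
  shows "monochromatic G f m"
proof -
  obtain vs es where len: "length vs = length es" "2 \<le> length es" and dist: "distinct es"
    and ends: "\<And>i. i < length es \<Longrightarrow> ends G (es ! i) = {vs ! i, vs ! (Suc i mod length vs)}"
    and C_eq: "C = set es"
    using C unfolding cycle_edge_set_def by auto
  define n where "n = length es"
  obtain k where k: "k < n" "es ! k = m"
    using m C_eq by (auto simp: in_set_conv_nth n_def)
  \<comment> \<open>Edge number \<open>k\<close> is \<open>m\<close>, so the walk starts at the
    vertex just after it. In \<open>j < n\<close> steps it never crosses \<open>m\<close>, and
    \<open>n - 1\<close> steps lead back to vertex \<open>k\<close>.\<close>
  have walk: "f (vs ! ((Suc k + j) mod n)) = f (vs ! (Suc k mod n))" if "j < n" for j
    using that
  proof (induction j)
    case (Suc j)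
    define i where "i = (Suc k + j) mod n"
    have i: "i < n" using k by (simp add: i_def)
    have "i \<noteq> k"
    proof
      assume "i = k"
      then have "(k + Suc j) mod n = k"
        by (simp add: i_def)
      then show False using Suc.prems k by (cases "k + Suc j < n") (auto simp: mod_less_double)
    qed
    then have "es ! i \<in> C - {m}"
      using dist i k by (auto simp: C_eq n_def nth_eq_iff_index_eq)
    then have "f (vs ! i) = f (vs ! (Suc i mod n))"
      using mono ends[of i] i len by (auto simp: monochromatic_def n_def)
    moreover have "Suc i mod n = (Suc k + Suc j) mod n"
      by (simp add: i_def mod_Suc_eq)
    ultimately show ?case
      using Suc by (simp add: i_def)
  qed simp
  have "(Suc k + (n - 1)) mod n = k"
    using k by (simp add: mod_less_double)
  then have "f (vs ! k) = f (vs ! (Suc k mod n))"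
    using walk[of "n - 1"] k by simp
  then show ?thesis
    using ends[of k] k len by (auto simp: monochromatic_def n_def)
qed

locale finite_graph =
  fixes G :: "('v, 'e) graph"
  assumes finite_verts: "finite (verts G)"
    and finite_edges: "finite (edges G)"
    and ends_subset: "e \<in> edges G \<Longrightarrow> ends G e \<subseteq> verts G"
    and card_ends: "e \<in> edges G \<Longrightarrow> card (ends G e) = 2"
begin

lemma finite_colorings: "finite (colorings G q F)"
  by (rule finite_subset[of _ "verts G \<rightarrow>\<^sub>E {..<q}"])
    (auto simp: colorings_def intro: finite_PiE finite_verts)

text \<open>A simple path of \<open>F\<close>-edges from \<open>u\<close> to \<open>v\<close> closes
  up with \<open>e\<close>; a path consisting of one edge parallel to \<open>e\<close> gives a cycle
  of length 2. Contrapositively, an edge that creates no cycle joins two different components of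
  \<open>F\<close>.\<close>

lemma cycle_of_path:
  assumes F: "F \<subseteq> edges G" and e: "e \<in> edges G" "e \<notin> F" and uv: "ends G e = {u, v}"
    and path: "(\<lambda>x y. \<exists>e'\<in>F. ends G e' = {x, y})\<^sup>*\<^sup>* u v"
  shows "\<exists>C. cycle_edge_set G C \<and> C \<subseteq> insert e F"
proof -
  define r where "r = (\<lambda>x y. \<exists>e'\<in>F. ends G e' = {x, y})"
  have "u \<noteq> v" using card_ends[OF e(1)] uv by auto
  obtain xs0 where "rtrancl_path r u xs0 v"
    using path rtranclp_eq_rtrancl_path[of r u v] unfolding r_def by blast
  then obtain xs where xs: "rtrancl_path r u xs v" and dist: "distinct (u # xs)"
    by (rule rtrancl_path_distinct)
  define vs where "vs = u # xs"
  have "xs \<noteq> []" using xs \<open>u \<noteq> v\<close> by (auto elim: rtrancl_path.cases)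
  have last: "vs ! length xs = v"
    using xs \<open>xs \<noteq> []\<close> unfolding vs_def
    by (metis last_ConsR last_conv_nth length_Suc_conv list.distinct(1) diff_Suc_1 length_Cons
        rtrancl_path_last)
  have "\<forall>i<length xs. \<exists>e'. e' \<in> F \<and> ends G e' = {vs ! i, vs ! Suc i}"
    using rtrancl_path_nth[OF xs] unfolding r_def vs_def by fastforce
  then obtain h where h: "\<And>i. i < length xs \<Longrightarrow> h i \<in> F \<and> ends G (h i) = {vs ! i, vs ! Suc i}"
    by metis
  have dist_vs: "distinct vs" using dist by (simp add: vs_def)
  \<comment> \<open>Two indices with the same endpoint pair agree, since the crossed matching would
    force \<open>i = Suc j\<close> and \<open>j = Suc i\<close>.\<close>
  have inj: "inj_on h {..<length xs}"
  proof (rule inj_onI)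
    fix i j assume ij: "i \<in> {..<length xs}" "j \<in> {..<length xs}" and "h i = h j"
    then have "{vs ! i, vs ! Suc i} = {vs ! j, vs ! Suc j}"
      using h[of i] h[of j] by simp
    then have "vs ! i = vs ! j \<or> vs ! i = vs ! Suc j \<and> vs ! Suc i = vs ! j"
      by (auto simp: doubleton_eq_iff)
    moreover have "i < length vs" "j < length vs" "Suc i < length vs" "Suc j < length vs"
      using ij by (auto simp: vs_def)
    ultimately show "i = j"
      using dist_vs by (auto simp: nth_eq_iff_index_eq)
  qed
  \<comment> \<open>With \<open>e\<close> in the last place, the index
    \<open>Suc i mod length vs\<close> wraps round to \<open>u\<close> exactly at
    \<open>e\<close>.\<close>
  define es where "es = map h [0..<length xs] @ [e]"
  have es_dist: "distinct es"
    using inj h e by (auto simp: es_def distinct_map atLeast0LessThan)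
  have es_ends: "ends G (es ! i) = {vs ! i, vs ! (Suc i mod length vs)}" if "i < length es" for i
  proof (cases "i < length xs")
    case True
    then show ?thesis using h by (simp add: es_def nth_append vs_def)
  next
    case False
    then have "i = length xs" using that by (simp add: es_def)
    then show ?thesis using last uv by (simp add: es_def nth_append vs_def insert_commute)
  qed
  have es_F: "set es \<subseteq> insert e F" using h by (auto simp: es_def)
  have vs_verts: "set vs \<subseteq> verts G"
  proof
    fix x assume "x \<in> set vs"
    then have "\<exists>i < length es. x = vs ! i"
      by (auto simp: in_set_conv_nth vs_def es_def)
    then obtain i where i: "i < length es" "x = vs ! i" by blast
    then have "x \<in> ends G (es ! i)" using es_ends by auto
    moreover have "es ! i \<in> edges G"
      using es_F F e nth_mem[OF i(1)] by auto
    ultimately show "x \<in> verts G" using ends_subset by blast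
  qed
  have "cycle_edge_set G (set es)"
    unfolding cycle_edge_set_def
  proof (intro exI conjI)
    show "length vs = length es" by (simp add: vs_def es_def)
    show "2 \<le> length es" using \<open>xs \<noteq> []\<close> by (cases xs) (auto simp: es_def)
    show "\<forall>i<length es. ends G (es ! i) = {vs ! i, vs ! (Suc i mod length vs)}"
      using es_ends by blast
    show "set es \<subseteq> edges G" using es_F F e by blast
  qed (rule es_dist vs_verts dist_vs refl)+
  then show ?thesis using es_F by blast
qed

text \<open>The ends of \<open>e\<close> lie in different components of \<open>F\<close>, so the
  colours on the component of \<open>u\<close> can be rotated without disturbing the edges of
  \<open>F\<close>. Exactly one rotation modulo \<open>q\<close> makes the colours of
  \<open>u\<close> and \<open>v\<close> agree, so a colouring for \<open>F\<close> amounts to a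
  colouring for \<open>insert e F\<close> together with a rotation.\<close>

lemma card_colorings_insert:
  assumes F: "F \<subseteq> edges G" and e: "e \<in> edges G" "e \<notin> F"
    and acyclic: "\<And>C. cycle_edge_set G C \<Longrightarrow> \<not> C \<subseteq> insert e F"
  shows "card (colorings G q (insert e F)) * q = card (colorings G q F)"
proof -
  obtain u v where uv: "ends G e = {u, v}" "u \<noteq> v"
    using card_ends[OF e(1)] by (auto simp: card_2_iff)
  have uvV: "u \<in> verts G" "v \<in> verts G" using ends_subset[OF e(1)] uv by auto
  define U where "U = {x. (\<lambda>x y. \<exists>e'\<in>F. ends G e' = {x, y})\<^sup>*\<^sup>* u x}"
  have vU: "v \<notin> U"
    unfolding U_def using cycle_of_path[OF F e uv(1)] acyclic by blast
  have uU: "u \<in> U" unfolding U_def by simp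
  have U_closed: "y \<in> U" if "x \<in> U" "e' \<in> F" "x \<in> ends G e'" "y \<in> ends G e'" for x y e'
  proof (cases "x = y")
    case False
    have "card (ends G e') = 2" using card_ends \<open>e' \<in> F\<close> F by blast
    then obtain a b where "ends G e' = {a, b}" by (auto simp: card_2_iff)
    then have "ends G e' = {x, y}" using that False by auto
    then show ?thesis
      using that by (auto simp: U_def intro: rtranclp.rtrancl_into_rtrancl)
  qed (use that in simp)
  \<comment> \<open>Off \<open>verts G\<close> the value stays \<open>undefined\<close>, as
    extensional colourings demand.\<close>
  define shift where
    "shift = (\<lambda>c (f :: 'v \<Rightarrow> nat) x. if x \<in> verts G then if x \<in> U then (f x + c) mod q else f x else undefined)"
  have shift_F: "shift c f \<in> colorings G q F" if f: "f \<in> colorings G q F" for c f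
  proof -
    have ran: "f x < q" if "x \<in> verts G" for x
      using f that by (auto simp: colorings_def PiE_def Pi_def)
    have "shift c f x < q" if "x \<in> verts G" for x
      using ran[OF that] that by (auto simp: shift_def)
    then have "shift c f \<in> verts G \<rightarrow>\<^sub>E {..<q}"
      by (auto simp: shift_def)
    moreover have "monochromatic G (shift c f) e'" if "e' \<in> F" for e'
    proof -
      have "monochromatic G f e'" using f \<open>e' \<in> F\<close> by (simp add: colorings_def)
      then have "shift c f x = shift c f y" if xy: "x \<in> ends G e'" "y \<in> ends G e'" for x y
      proof -
        have "f x = f y" using \<open>monochromatic G f e'\<close> xy unfolding monochromatic_def by blast
        moreover have "x \<in> verts G" "y \<in> verts G" using xy ends_subset F \<open>e' \<in> F\<close> by blast+
        moreover have "x \<in> U \<longleftrightarrow> y \<in> U" using U_closed[OF _ \<open>e' \<in> F\<close>] xy by blast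
        ultimately show ?thesis by (simp add: shift_def)
      qed
      then show ?thesis
        unfolding monochromatic_def by blast
    qed
    ultimately show ?thesis by (simp add: colorings_def)
  qed
  have mono_e: "monochromatic G f e \<longleftrightarrow> f u = f v" for f :: "'v \<Rightarrow> nat"
    using uv by (auto simp: monochromatic_def)
  have "bij_betw (\<lambda>(f, c). shift c f) (colorings G q (insert e F) \<times> {..<q}) (colorings G q F)"
  \<comment> \<open>The rotation to undo is the difference of the colours at \<open>u\<close> and
    \<open>v\<close>; adding \<open>q - f v\<close> and \<open>q - c\<close> replaces subtraction
    modulo \<open>q\<close> on the naturals.\<close>
  proof (rule bij_betwI[where g = "\<lambda>f. let c = (f u + (q - f v)) mod q in (shift (q - c) f, c)"])
    show "(\<lambda>(f, c). shift c f) \<in> colorings G q (insert e F) \<times> {..<q} \<rightarrow> colorings G q F"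
      using shift_F by (auto simp: colorings_def)
    show "(\<lambda>f. let c = (f u + (q - f v)) mod q in (shift (q - c) f, c))
        \<in> colorings G q F \<rightarrow> colorings G q (insert e F) \<times> {..<q}"
    proof
      fix f assume f: "f \<in> colorings G q F"
      then have fuv: "f u < q" "f v < q" using uvV by (auto simp: colorings_def PiE_def Pi_def)
      define c where "c = (f u + (q - f v)) mod q"
      have c: "c < q" using fuv by (simp add: c_def)
      have "(f u + (q - c)) mod q = f v"
        using fuv unfolding c_def by (auto simp: mod_less_double split: if_splits)
      then have "shift (q - c) f \<in> colorings G q (insert e F)"
        using shift_F[OF f, of "q - c"] uU vU uvV
        unfolding colorings_def by (simp add: mono_e) (simp add: shift_def)
      then show "(let c = (f u + (q - f v)) mod q in (shift (q - c) f, c))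
          \<in> colorings G q (insert e F) \<times> {..<q}"
        using c by (simp add: c_def Let_def)
    qed
  next
    fix p assume "p \<in> colorings G q (insert e F) \<times> {..<q}"
    then obtain f c where p: "p = (f, c)" and f: "f \<in> colorings G q (insert e F)" and c: "c < q"
      by auto
    have fuv: "f u = f v" using f by (simp add: colorings_def mono_e)
    have ran: "f x < q" if "x \<in> verts G" for x
      using f that by (auto simp: colorings_def PiE_def Pi_def)
    have s: "shift c f u = (f v + c) mod q" "shift c f v = f v"
      using uU vU uvV fuv by (auto simp: shift_def)
    have 1: "((f v + c) mod q + (q - f v)) mod q = c"
      using ran[OF uvV(2)] c by (auto simp: mod_less_double split: if_splits)
    have "((f x + c) mod q + (q - c)) mod q = f x" if "x \<in> verts G" for x
      using ran[OF that] c by (auto simp: mod_less_double split: if_splits)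
    then have "shift (q - c) (shift c f) = f"
      using f by (intro ext) (auto simp: shift_def colorings_def PiE_def extensional_def)
    then show "(let c = ((case p of (f, c) \<Rightarrow> shift c f) u + (q - (case p of (f, c) \<Rightarrow> shift c f) v)) mod q
        in (shift (q - c) (case p of (f, c) \<Rightarrow> shift c f), c)) = p"
      by (simp add: p s 1 Let_def)
  next
    fix f assume f: "f \<in> colorings G q F"
    have ran: "f x < q" if "x \<in> verts G" for x
      using f that by (auto simp: colorings_def PiE_def Pi_def)
    define c where "c = (f u + (q - f v)) mod q"
    have c: "c < q" using ran[OF uvV(1)] by (simp add: c_def)
    have "((f x + (q - c)) mod q + c) mod q = f x" if "x \<in> verts G" for x
      using ran[OF that] c by (auto simp: mod_less_double split: if_splits)
    then have "shift c (shift (q - c) f) = f"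
      using f by (intro ext) (auto simp: shift_def colorings_def PiE_def extensional_def)
    then show "(case let c = (f u + (q - f v)) mod q in (shift (q - c) f, c) of (f, c) \<Rightarrow> shift c f) = f"
      by (simp add: c_def Let_def)
  qed
  then show ?thesis
    by (auto dest: bij_betw_same_card simp: card_cartesian_product)
qed

text \<open>Each edge added to a forest divides the number of compatible colourings by
  \<open>q\<close>. The product form avoids the exponent \<open>card (verts G) - card F\<close>: the
  bound on \<open>card F\<close> that makes it a true difference is itself derived from this
  count.\<close>

lemma card_colorings_forest:
  assumes "F \<subseteq> edges G" and "\<And>C. cycle_edge_set G C \<Longrightarrow> \<not> C \<subseteq> F"
  shows "card (colorings G q F) * q ^ card F = q ^ card (verts G)"
proof -
  have "finite F" using assms(1) finite_edges finite_subset by blast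
  then show ?thesis using assms
  proof (induction F rule: finite_induct)
    case empty
    show ?case by (simp add: colorings_def card_PiE finite_verts)
  next
    case (insert e F)
    have "card (colorings G q (insert e F)) * q = card (colorings G q F)"
      using insert.prems insert.hyps by (intro card_colorings_insert) auto
    moreover have "card (colorings G q F) * q ^ card F = q ^ card (verts G)"
      using insert.prems by (intro insert.IH) blast+
    ultimately show ?case using insert.hyps by (simp add: mult.assoc[symmetric])
  qed
qed

text \<open>Two colours replace a count of components: both constant colourings are compatible with
  the forest, so \<open>2 * 2 ^ card F\<close> is at most \<open>2 ^ card (verts G)\<close>.\<close>

lemma card_forest_less:
  assumes "F \<subseteq> edges G" and "\<And>C. cycle_edge_set G C \<Longrightarrow> \<not> C \<subseteq> F" and "verts G \<noteq> {}"
  shows "card F < card (verts G)"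
proof -
  obtain w where w: "w \<in> verts G" using assms(3) by blast
  have "(\<lambda>x\<in>verts G. c) \<in> colorings G 2 F" if "c < 2" for c
    using that assms(1) ends_subset by (fastforce simp: colorings_def monochromatic_def)
  then have "{\<lambda>x\<in>verts G. 0, \<lambda>x\<in>verts G. 1} \<subseteq> colorings G 2 F" by simp
  moreover have "(\<lambda>x\<in>verts G. 0) \<noteq> (\<lambda>x\<in>verts G. (1::nat))"
    using w by (metis restrict_apply' zero_neq_one)
  ultimately have "2 \<le> card (colorings G 2 F)"
    using card_mono[OF finite_colorings, of "{\<lambda>x\<in>verts G. 0, \<lambda>x\<in>verts G. 1}" 2 F] by simp
  then have "2 * 2 ^ card F \<le> card (colorings G 2 F) * 2 ^ card F" by simp
  also have "\<dots> = 2 ^ card (verts G)" by (rule card_colorings_forest[OF assms(1,2)])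
  finally have "(2::nat) ^ Suc (card F) \<le> 2 ^ card (verts G)" by simp
  then have "Suc (card F) \<le> card (verts G)" by (rule power_le_imp_le_exp[rotated]) simp
  then show ?thesis by simp
qed

end


section \<open>Whitney's broken-circuit theorem\<close>

locale ordered_graph = finite_graph G for G :: "('v, 'e) graph" +
  fixes ord :: "('e \<times> 'e) set"
  assumes linear_order: "linear_order_on (edges G) ord"
begin

abbreviation "BC \<equiv> broken_circuit_complex G ord"

lemma finite_BC: "finite BC"
  by (rule finite_subset[of _ "Pow (edges G)"])
    (use finite_edges in \<open>auto simp: broken_circuit_complex_def\<close>)

lemma has_maximum:
  assumes "M \<subseteq> edges G" "M \<noteq> {}"
  obtains m where "m \<in> M" "\<And>c. c \<in> M \<Longrightarrow> (c, m) \<in> ord"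
proof -
  have "finite M" using assms finite_edges finite_subset by blast
  then have "M \<noteq> {} \<Longrightarrow> M \<subseteq> edges G \<Longrightarrow> \<exists>m\<in>M. \<forall>c\<in>M. (c, m) \<in> ord"
  proof (induction M rule: finite_induct)
    case (insert x M)
    have lin: "refl_on (edges G) ord" "trans ord" "total_on (edges G) ord"
      using linear_order by (auto simp: order_on_defs)
    show ?case
    proof (cases "M = {}")
      case True
      then show ?thesis using insert.prems lin(1) by (auto simp: refl_on_def)
    next
      case False
      then obtain m where m: "m \<in> M" "\<forall>c\<in>M. (c, m) \<in> ord"
        using insert by auto
      show ?thesis
      proof (cases "(x, m) \<in> ord")
        case False
        then have "(m, x) \<in> ord"
          using lin insert.prems insert.hyps m by (auto simp: total_on_def)
        then have "\<forall>c\<in>insert x M. (c, x) \<in> ord"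
          using m lin insert.prems by (auto simp: refl_on_def dest: transD)
        then show ?thesis by blast
      qed (use m in auto)
    qed
  qed simp
  then show thesis using assms that by blast
qed

lemma cycle_subset_edges: "cycle_edge_set G C \<Longrightarrow> C \<subseteq> edges G"
  by (auto simp: cycle_edge_set_def)

lemma card_cycle_ge_2: "cycle_edge_set G C \<Longrightarrow> 2 \<le> card C"
  by (auto simp: cycle_edge_set_def distinct_card)

lemma broken_circuit_subset_edges: "broken_circuit G ord B \<Longrightarrow> B \<subseteq> edges G"
  using cycle_subset_edges by (auto simp: broken_circuit_def)

lemma broken_circuit_nonempty: "broken_circuit G ord B \<Longrightarrow> B \<noteq> {}"
  using card_cycle_ge_2 by (fastforce simp: broken_circuit_def dest: subset_singletonD)

text \<open>A cycle has at least two edges, so a broken circuit is never empty. The empty face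
  supplies the term 1 for an empty flat and keeps the quotient ring from being zero.\<close>

lemma empty_in_BC: "{} \<in> BC"
  using broken_circuit_nonempty by (auto simp: broken_circuit_complex_def)

text \<open>A cycle contains its own broken circuit. Faces are therefore forests, and the colouring
  count for forests applies to them.\<close>

lemma BC_acyclic:
  assumes "F \<in> BC" "cycle_edge_set G C"
  shows "\<not> C \<subseteq> F"
proof
  assume "C \<subseteq> F"
  have "C \<noteq> {}" using card_cycle_ge_2[OF assms(2)] by auto
  then obtain m where "m \<in> C" "\<And>c. c \<in> C \<Longrightarrow> (c, m) \<in> ord"
    using has_maximum cycle_subset_edges[OF assms(2)] by metis
  then have "broken_circuit G ord (C - {m})"
    using assms(2) by (auto simp: broken_circuit_def)
  then show False
    using assms(1) \<open>C \<subseteq> F\<close> by (auto simp: broken_circuit_complex_def)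
qed

text \<open>Toggling the largest edge of a nonempty flat is a sign-reversing involution on the faces
  inside the flat: a broken circuit created by adding it would come from a cycle whose largest edge
  is even larger, but lies in the flat.\<close>

lemma alternating_sum_flat:
  assumes M: "M \<subseteq> edges G" "M \<noteq> {}"
    and flat: "\<And>C m. cycle_edge_set G C \<Longrightarrow> m \<in> C \<Longrightarrow> C - {m} \<subseteq> M \<Longrightarrow> m \<in> M"
  shows "(\<Sum>F\<in>{F \<in> BC. F \<subseteq> M}. (-1) ^ card F) = (0::int)"
proof -
  obtain e where e: "e \<in> M" "\<And>c. c \<in> M \<Longrightarrow> (c, e) \<in> ord"
    using has_maximum[OF M] by metis
  define S where "S = {F \<in> BC. F \<subseteq> M}"
  have finS: "finite S" using finite_BC by (simp add: S_def)
  have fin: "finite F" if "F \<in> S" for F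
    using that M finite_edges by (auto simp: S_def dest!: finite_subset[OF subset_trans])
  have ins: "insert e F \<in> S" if F: "F \<in> S" for F
  proof -
    have "\<not> B \<subseteq> insert e F" if B: "broken_circuit G ord B" for B
    proof
      assume sub: "B \<subseteq> insert e F"
      obtain C m where C: "cycle_edge_set G C" "m \<in> C" "\<forall>c\<in>C. (c, m) \<in> ord" "B = C - {m}"
        using B by (auto simp: broken_circuit_def)
      have "B \<subseteq> M" using sub F e by (auto simp: S_def)
      then have "m \<in> M" using flat C by blast
      then have "(m, e) \<in> ord" using e by blast
      moreover have "e \<in> B" using sub F B by (auto simp: S_def broken_circuit_complex_def)
      then have "(e, m) \<in> ord" "e \<noteq> m" using C by auto
      ultimately show False
        using linear_order by (auto simp: order_on_defs antisym_def)
    qed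
    then show ?thesis
      using F e M by (auto simp: S_def broken_circuit_complex_def)
  qed
  have del: "F - {e} \<in> S" if "F \<in> S" for F
    using that by (auto simp: S_def broken_circuit_complex_def)
  let ?S0 = "{F \<in> S. e \<notin> F}" and ?S1 = "{F \<in> S. e \<in> F}"
  have "(\<Sum>F\<in>S. (-1) ^ card F) = (\<Sum>F\<in>?S0. (-1) ^ card F) + (\<Sum>F\<in>?S1. (-1) ^ card F :: int)"
    using finS by (subst sum.union_disjoint[symmetric]) (auto intro: sum.cong)
  also have "(\<Sum>F\<in>?S1. (-1) ^ card F :: int) = (\<Sum>F\<in>?S0. (-1) ^ card (insert e F))"
    by (rule sum.reindex_bij_witness[of _ "insert e" "\<lambda>F. F - {e}"])
      (auto simp: insert_absorb ins del)
  also have "\<dots> = (\<Sum>F\<in>?S0. - ((-1) ^ card F))"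
    using fin by (intro sum.cong) auto
  finally show ?thesis by (simp add: S_def sum_negf)
qed

theorem whitney_broken_circuit:
  "(\<Sum>F\<in>BC. (-1) ^ card F * int (card (colorings G q F)))
    = int (card {f \<in> verts G \<rightarrow>\<^sub>E {..<q}. \<forall>e\<in>edges G. \<not> monochromatic G f e})"
proof -
  define P where "P = verts G \<rightarrow>\<^sub>E {..<q}"
  define M where "M = (\<lambda>f :: 'v \<Rightarrow> nat. {e \<in> edges G. monochromatic G f e})"
  have finP: "finite P" unfolding P_def by (intro finite_PiE finite_verts) auto
  \<comment> \<open>Faces consist of edges, so compatibility of \<open>f\<close> with
    \<open>F\<close> is the inclusion of \<open>F\<close> in the flat \<open>M f\<close>; this lets
    the sums over faces and colourings be exchanged.\<close>
  have col: "colorings G q F = {f \<in> P. F \<subseteq> M f}" if "F \<in> BC" for F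
    using that by (auto simp: colorings_def P_def M_def broken_circuit_complex_def)
  have inner: "(\<Sum>F\<in>{F \<in> BC. F \<subseteq> M f}. (-1) ^ card F) = (if M f = {} then 1 else 0::int)" for f
  proof (cases "M f = {}")
    case True
    then have "{F \<in> BC. F \<subseteq> M f} = {{}}" using empty_in_BC by auto
    then show ?thesis using True by simp
  next
    case False
    moreover have "m \<in> M f" if "cycle_edge_set G C" "m \<in> C" "C - {m} \<subseteq> M f" for C m
      using that cycle_edge_set_monochromatic[of G C m f] cycle_subset_edges by (auto simp: M_def)
    ultimately show ?thesis
      using alternating_sum_flat[of "M f"] by (simp add: M_def)
  qed
  have "(\<Sum>F\<in>BC. (-1) ^ card F * int (card (colorings G q F)))
      = (\<Sum>F\<in>BC. \<Sum>f\<in>P. if F \<subseteq> M f then (-1) ^ card F else 0)"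
    by (intro sum.cong refl) (simp add: col finP sum.If_cases Int_def mult.commute)
  also have "\<dots> = (\<Sum>f\<in>P. \<Sum>F\<in>BC. if F \<subseteq> M f then (-1) ^ card F else 0)"
    by (rule sum.swap)
  also have "\<dots> = (\<Sum>f\<in>P. if M f = {} then 1 else 0)"
    by (simp add: sum.If_cases finite_BC Int_def inner)
  also have "\<dots> = int (card {f \<in> P. M f = {}})"
    by (simp add: sum.If_cases finP Int_def)
  finally show ?thesis by (simp add: P_def M_def Ball_def)
qed

end


section \<open>The Hilbert series of the broken-circuit complex\<close>

lemma keys_plus_nat:
  "Poly_Mapping.keys (a + b) = Poly_Mapping.keys a \<union> Poly_Mapping.keys b"
  for a b :: "'e \<Rightarrow>\<^sub>0 nat"
  by (auto simp: in_keys_iff lookup_add)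

lemma monomial_degree_superset:
  assumes "finite A" "Poly_Mapping.keys m \<subseteq> A"
  shows "monomial_degree m = (\<Sum>e\<in>A. Poly_Mapping.lookup m e)"
  unfolding monomial_degree_def
  by (rule sum.mono_neutral_left[OF assms]) (auto simp: in_keys_iff)

lemma monomial_degree_plus: "monomial_degree (a + b) = monomial_degree a + monomial_degree b"
proof -
  let ?A = "Poly_Mapping.keys a \<union> Poly_Mapping.keys b"
  have "monomial_degree (a + b) = (\<Sum>e\<in>?A. Poly_Mapping.lookup (a + b) e)"
    by (rule monomial_degree_superset) (auto simp: keys_plus_nat)
  also have "\<dots> = monomial_degree a + monomial_degree b"
    using monomial_degree_superset[of ?A a] monomial_degree_superset[of ?A b]
    by (simp add: lookup_add sum.distrib)
  finally show ?thesis .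
qed

lemma monomial_degree_single: "monomial_degree (Poly_Mapping.single e k) = k"
  using monomial_degree_superset[of "{e}" "Poly_Mapping.single e k"] by simp

text \<open>A monomial supported in \<open>A\<close> is determined by its exponents on
  \<open>A\<close>, each of which is at most the degree.\<close>

lemma finite_monomials:
  fixes A :: "'e set"
  assumes "finite A"
  shows "finite {m. Poly_Mapping.keys m \<subseteq> A \<and> monomial_degree m = d}" (is "finite ?M")
proof (rule inj_on_finite)
  show "inj_on (\<lambda>m. restrict (Poly_Mapping.lookup m) A) ?M"
  proof (rule inj_onI, rule poly_mapping_eqI)
    fix m m' :: "'e \<Rightarrow>\<^sub>0 nat" and e
    assume *: "m \<in> ?M" "m' \<in> ?M"
      "restrict (Poly_Mapping.lookup m) A = restrict (Poly_Mapping.lookup m') A"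
    show "Poly_Mapping.lookup m e = Poly_Mapping.lookup m' e"
    proof (cases "e \<in> A")
      case True
      then show ?thesis using fun_cong[OF *(3), of e] by simp
    next
      case False
      then have "e \<notin> Poly_Mapping.keys m" "e \<notin> Poly_Mapping.keys m'" using * by auto
      then show ?thesis by (simp add: in_keys_iff)
    qed
  qed
  show "(\<lambda>m. restrict (Poly_Mapping.lookup m) A) ` ?M \<subseteq> A \<rightarrow>\<^sub>E {..d}"
  proof (clarsimp simp: PiE_iff)
    fix m :: "'e \<Rightarrow>\<^sub>0 nat" and e assume "Poly_Mapping.keys m \<subseteq> A" "e \<in> A"
    then show "Poly_Mapping.lookup m e \<le> monomial_degree m"
      using assms by (subst monomial_degree_superset[of A]) (auto intro: member_le_sum)
  qed
  show "finite (A \<rightarrow>\<^sub>E {..d})" using assms by (intro finite_PiE) auto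
qed

text \<open>Dividing by the variable of \<open>e\<close> leaves a monomial whose support either
  still contains \<open>e\<close> or has shrunk to \<open>F\<close>. For the generating functions
  this reads (1 - z) g(F + e) = z g(F).\<close>

lemma card_monomials_insert:
  fixes e :: 'e
  assumes "finite F" "e \<notin> F"
  shows "card {m. Poly_Mapping.keys m = insert e F \<and> monomial_degree m = Suc d}
    = card {m. Poly_Mapping.keys m = insert e F \<and> monomial_degree m = d}
      + card {m. Poly_Mapping.keys m = F \<and> monomial_degree m = d}"
proof -
  define N where "N = (\<lambda>(F :: 'e set) d. {m. Poly_Mapping.keys m = F \<and> monomial_degree m = d})"
  let ?x = "Poly_Mapping.single e (1::nat)"
  have fin: "finite (N A d)" if "finite A" for A :: "'e set" and d
    by (rule finite_subset[OF _ finite_monomials[OF that, of d]]) (auto simp: N_def)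
  \<comment> \<open>Subtraction of exponents is truncated; it inverts addition here because
    \<open>e\<close> occurs in \<open>m\<close>.\<close>
  have sub: "m - ?x + ?x = m" if "m \<in> N (insert e F) (Suc d)" for m
  proof (rule poly_mapping_eqI)
    fix k
    have "e \<in> Poly_Mapping.keys m" using that by (simp add: N_def)
    then have "Poly_Mapping.lookup m e > 0" by (simp add: in_keys_iff)
    then show "Poly_Mapping.lookup (m - ?x + ?x) k = Poly_Mapping.lookup m k"
      by (auto simp: lookup_add lookup_minus lookup_single when_def)
  qed
  have "bij_betw (\<lambda>m. m + ?x) (N (insert e F) d \<union> N F d) (N (insert e F) (Suc d))"
  proof (rule bij_betwI[where g = "\<lambda>m. m - ?x"])
    show "(\<lambda>m. m + ?x) \<in> N (insert e F) d \<union> N F d \<rightarrow> N (insert e F) (Suc d)"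
      by (auto simp: N_def keys_plus_nat monomial_degree_plus monomial_degree_single)
    show "(\<lambda>m. m - ?x) \<in> N (insert e F) (Suc d) \<rightarrow> N (insert e F) d \<union> N F d"
    proof
      fix m assume m: "m \<in> N (insert e F) (Suc d)"
      have "monomial_degree (m - ?x) + 1 = Suc d"
        using m sub[OF m] monomial_degree_plus[of "m - ?x" ?x]
        by (simp add: N_def monomial_degree_single)
      moreover have "Poly_Mapping.keys (m - ?x) \<union> {e} = insert e F"
        using m sub[OF m] keys_plus_nat[of "m - ?x" ?x] by (simp add: N_def)
      then have "Poly_Mapping.keys (m - ?x) = insert e F \<or> Poly_Mapping.keys (m - ?x) = F"
        using assms(2)
        by (cases "e \<in> Poly_Mapping.keys (m - ?x)") (auto simp: insert_absorb insert_ident)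
      ultimately show "m - ?x \<in> N (insert e F) d \<union> N F d" by (auto simp: N_def)
    qed
  qed (use sub in auto)
  then have "card (N (insert e F) (Suc d)) = card (N (insert e F) d \<union> N F d)"
    by (simp add: bij_betw_same_card)
  also have "\<dots> = card (N (insert e F) d) + card (N F d)"
    using assms by (intro card_Un_disjoint fin) (auto simp: N_def)
  finally show ?thesis by (simp add: N_def)
qed

text \<open>Each variable of \<open>F\<close> occurs with a positive exponent and contributes z +
  z^2 + ... = z / (1 - z).\<close>

lemma monomials_generating_function:
  assumes "finite F"
  shows "Abs_fps (\<lambda>d. of_nat (card {m. Poly_Mapping.keys m = F \<and> monomial_degree m = d}))
    = (fps_X * inverse (1 - fps_X) :: 'a::field_char_0 fps) ^ card F"
  using assms
proof (induction F rule: finite_induct)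
  case empty
  have "{m :: 'b \<Rightarrow>\<^sub>0 nat. Poly_Mapping.keys m = {} \<and> monomial_degree m = d} = (if d = 0 then {0} else {})" for d
    by (auto simp: monomial_degree_def)
  then show ?case by (auto simp: fps_eq_iff)
next
  case (insert e F)
  define g :: "'b set \<Rightarrow> 'a fps" where
    "g = (\<lambda>F. Abs_fps (\<lambda>d. of_nat (card {m. Poly_Mapping.keys m = F \<and> monomial_degree m = d})))"
  have unit: "inverse (1 - fps_X) * (1 - fps_X) = (1 :: 'a fps)"
    by (rule inverse_mult_eq_1) simp
  have "(1 - fps_X) * g (insert e F) = fps_X * g F"
  proof (rule fps_ext)
    fix n
    show "fps_nth ((1 - fps_X) * g (insert e F)) n = fps_nth (fps_X * g F) n"
    proof (cases n)
      case 0
      \<comment> \<open>The recurrence speaks of positive degrees only; in degree 0 the support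
        would have to be empty.\<close>
      have none: "{m :: 'b \<Rightarrow>\<^sub>0 nat. Poly_Mapping.keys m = insert e F \<and> monomial_degree m = 0} = {}"
      proof -
        have False if "Poly_Mapping.keys m = insert e F" "monomial_degree m = 0" for m :: "'b \<Rightarrow>\<^sub>0 nat"
        proof -
          have "e \<in> Poly_Mapping.keys m" using that by simp
          moreover have "\<forall>k\<in>Poly_Mapping.keys m. Poly_Mapping.lookup m k = 0"
            using that(2) by (simp add: monomial_degree_def)
          ultimately show False by (simp add: in_keys_iff)
        qed
        then show ?thesis by blast
      qed
      have "fps_nth (g (insert e F)) 0 = 0" unfolding g_def fps_nth_Abs_fps none by simp
      then show ?thesis by (simp add: 0)
    next
      case (Suc d)
      then show ?thesis
        by (simp add: left_diff_distrib g_def card_monomials_insert[OF insert.hyps])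
    qed
  qed
  then have "inverse (1 - fps_X) * (1 - fps_X) * g (insert e F) = fps_X * inverse (1 - fps_X) * g F"
    by (simp add: mult_ac)
  then show ?case
    using insert by (simp add: unit g_def)
qed


section \<open>The coefficient field, the polynomial ring and squarefree monomials\<close>

definition field_ring :: "'k::field ring" where
  "field_ring = \<lparr>carrier = UNIV, monoid.mult = (*), one = 1, zero = 0, add = (+)\<rparr>"

lemma field_field_ring: "field (field_ring :: 'k::field ring)"
proof -
  have "cring (field_ring :: 'k ring)"
    by (intro cringI abelian_groupI comm_monoidI)
      (auto simp: field_ring_def algebra_simps intro: exI[of _ "- x" for x])
  then show ?thesis
  proof (rule cring.cring_fieldI)
    have "\<exists>y. y * x = 1 \<and> x * y = 1" if "x \<noteq> 0" for x :: 'k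
      using that by (intro exI[of _ "inverse x"]) auto
    then show "Units (field_ring :: 'k ring) = carrier field_ring - {\<zero>\<^bsub>field_ring\<^esub>}"
      by (auto simp: Units_def field_ring_def)
  qed
qed

lemma cring_poly_ring: "cring (poly_ring E :: ('e, 'k::field) mpoly ring)"
proof (intro cringI abelian_groupI comm_monoidI)
  fix p q :: "('e, 'k) mpoly"
  assume p: "p \<in> carrier (poly_ring E)" and q: "q \<in> carrier (poly_ring E)"
  show "p \<oplus>\<^bsub>poly_ring E\<^esub> q \<in> carrier (poly_ring E)"
    using p q Poly_Mapping.keys_add[of p q] by (auto simp: poly_ring_def)
  show "p \<otimes>\<^bsub>poly_ring E\<^esub> q \<in> carrier (poly_ring E)"
    using p q Poly_Mapping.keys_mult[of p q] by (fastforce simp: poly_ring_def keys_plus_nat)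
next
  fix p :: "('e, 'k) mpoly"
  assume "p \<in> carrier (poly_ring E)"
  then show "\<exists>q\<in>carrier (poly_ring E). q \<oplus>\<^bsub>poly_ring E\<^esub> p = \<zero>\<^bsub>poly_ring E\<^esub>"
    by (intro bexI[of _ "- p"]) (auto simp: poly_ring_def in_keys_iff)
qed (auto simp: poly_ring_def algebra_simps)

lemma a_inv_poly_ring:
  assumes "p \<in> carrier (poly_ring E)"
  shows "\<ominus>\<^bsub>poly_ring E\<^esub> p = - p"
proof -
  interpret cring "poly_ring E" by (rule cring_poly_ring)
  show ?thesis
    by (rule minus_equality) (use assms in \<open>auto simp: poly_ring_def in_keys_iff\<close>)
qed

lemma poly_mapping_sum_singles:
  "(\<Sum>m\<in>Poly_Mapping.keys p. Poly_Mapping.single m (Poly_Mapping.lookup p m)) = p"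
  by (rule poly_mapping_eqI) (auto simp: lookup_sum lookup_single when_def in_keys_iff)

definition squarefree_monomial :: "'e set \<Rightarrow> 'e \<Rightarrow>\<^sub>0 nat" where
  "squarefree_monomial B = (\<Sum>e\<in>B. Poly_Mapping.single e 1)"

lemma lookup_squarefree_monomial:
  "finite B \<Longrightarrow> Poly_Mapping.lookup (squarefree_monomial B) e = (if e \<in> B then 1 else 0)"
  by (simp add: squarefree_monomial_def lookup_sum lookup_single when_def)

lemma keys_squarefree_monomial: "finite B \<Longrightarrow> Poly_Mapping.keys (squarefree_monomial B) = B"
  by (auto simp: in_keys_iff lookup_squarefree_monomial split: if_splits)

lemma prod_var: "finite B \<Longrightarrow> (\<Prod>e\<in>B. var e) = Poly_Mapping.single (squarefree_monomial B) 1"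
  by (induction B rule: finite_induct)
    (auto simp: squarefree_monomial_def var_def mult_single)

section \<open>The Stanley-Reisner ideal\<close>

context ordered_graph
begin

lemma BC_iff: "F \<subseteq> edges G \<Longrightarrow> F \<in> BC \<longleftrightarrow> \<not> (\<exists>B. broken_circuit G ord B \<and> B \<subseteq> F)"
  by (simp add: broken_circuit_complex_def)

lemma BC_subset_edges: "F \<in> BC \<Longrightarrow> F \<subseteq> edges G"
  by (simp add: broken_circuit_complex_def)

lemma finite_broken_circuit: "broken_circuit G ord B \<Longrightarrow> finite B"
  using broken_circuit_subset_edges finite_edges finite_subset by blast

text \<open>A set of edges containing a nonface is a nonface, and supports of monomials unite under
  multiplication because natural exponents cannot cancel. By minimality of the generated ideal, this
  bounds \<open>bc_ideal\<close> from above.\<close>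

lemma ideal_nonface_polynomials:
  "ideal {p \<in> carrier (poly_ring (edges G)). \<forall>m\<in>Poly_Mapping.keys p. Poly_Mapping.keys m \<notin> BC}
    (poly_ring (edges G) :: ('e, 'k::field) mpoly ring)" (is "ideal ?J ?R")
proof (rule idealI)
  interpret R: cring ?R by (rule cring_poly_ring)
  show "ring ?R" ..
  show "subgroup ?J (add_monoid ?R)"
  proof (rule R.add.subgroupI)
    show "?J \<noteq> {}" by (auto simp: poly_ring_def intro: exI[of _ 0])
  next
    fix p assume "p \<in> ?J"
    then show "\<ominus>\<^bsub>?R\<^esub> p \<in> ?J"
      using a_inv_poly_ring[of p "edges G"] by (auto simp: poly_ring_def in_keys_iff)
  next
    fix p q assume "p \<in> ?J" "q \<in> ?J"
    then show "p \<oplus>\<^bsub>?R\<^esub> q \<in> ?J"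
      by (auto simp: poly_ring_def dest!: subsetD[OF Poly_Mapping.keys_add])
  qed auto
  have mult: "p * q \<in> ?J" if p: "p \<in> ?J" and q: "q \<in> carrier ?R" for p q
  proof -
    have "Poly_Mapping.keys m \<notin> BC" if "m \<in> Poly_Mapping.keys (p * q)" for m
    proof -
      obtain a b where m: "m = a + b" "a \<in> Poly_Mapping.keys p" "b \<in> Poly_Mapping.keys q"
        using subsetD[OF Poly_Mapping.keys_mult \<open>m \<in> Poly_Mapping.keys (p * q)\<close>] by auto
      have "Poly_Mapping.keys a \<notin> BC" "Poly_Mapping.keys a \<subseteq> edges G"
        using m p by (auto simp: poly_ring_def)
      then obtain B where "broken_circuit G ord B" "B \<subseteq> Poly_Mapping.keys a"
        using BC_iff by blast
      then show ?thesis
        unfolding m(1) keys_plus_nat by (auto simp: broken_circuit_complex_def)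
    qed
    moreover have "p \<otimes>\<^bsub>?R\<^esub> q \<in> carrier ?R"
      using p q by (intro R.m_closed) simp_all
    moreover have "p \<otimes>\<^bsub>?R\<^esub> q = p * q" by (simp add: poly_ring_def)
    ultimately show ?thesis by simp
  qed
  fix p x assume "p \<in> ?J" "x \<in> carrier ?R"
  then have "p * x \<in> ?J" by (rule mult)
  moreover have "p \<otimes>\<^bsub>?R\<^esub> x = p * x" "x \<otimes>\<^bsub>?R\<^esub> p = p * x"
    by (simp_all add: poly_ring_def mult.commute)
  ultimately show "x \<otimes>\<^bsub>?R\<^esub> p \<in> ?J" "p \<otimes>\<^bsub>?R\<^esub> x \<in> ?J" by simp_all
qed

lemma broken_circuit_monomials_in_carrier:
  "{\<Prod>e\<in>B. var e | B. broken_circuit G ord B}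
    \<subseteq> carrier (poly_ring (edges G) :: ('e, 'k::field) mpoly ring)"
proof (clarify)
  fix B assume B: "broken_circuit G ord B"
  show "(\<Prod>e\<in>B. var e) \<in> carrier (poly_ring (edges G) :: ('e, 'k) mpoly ring)"
    using broken_circuit_subset_edges[OF B]
    by (simp add: poly_ring_def prod_var keys_squarefree_monomial finite_broken_circuit[OF B])
qed

lemma ideal_bc_ideal:
  "ideal (bc_ideal G ord) (poly_ring (edges G) :: ('e, 'k::field) mpoly ring)"
proof -
  interpret R: cring "poly_ring (edges G) :: ('e, 'k) mpoly ring" by (rule cring_poly_ring)
  show ?thesis
    unfolding bc_ideal_def by (rule R.genideal_ideal[OF broken_circuit_monomials_in_carrier])
qed

text \<open>In a monomial ideal membership is decided term by term: a monomial whose support is a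
  nonface is a multiple of the generator of some broken circuit inside that support.\<close>

lemma bc_ideal_eq:
  "(bc_ideal G ord :: ('e, 'k::field) mpoly set)
    = {p \<in> carrier (poly_ring (edges G)). \<forall>m\<in>Poly_Mapping.keys p. Poly_Mapping.keys m \<notin> BC}"
  (is "?I = ?J")
proof
  let ?R = "poly_ring (edges G) :: ('e, 'k) mpoly ring"
  interpret R: cring ?R by (rule cring_poly_ring)
  interpret I: ideal ?I ?R by (rule ideal_bc_ideal)
  have gens: "(\<Prod>e\<in>B. var e) \<in> ?I" if "broken_circuit G ord B" for B
    unfolding bc_ideal_def
    using R.genideal_self[OF broken_circuit_monomials_in_carrier] that by blast
  show "?I \<subseteq> ?J"
    unfolding bc_ideal_def
  proof (rule R.genideal_minimal[OF ideal_nonface_polynomials], clarify)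
    fix B assume B: "broken_circuit G ord B"
    then show "(\<Prod>e\<in>B. var e) \<in> carrier ?R \<and>
        (\<forall>m\<in>Poly_Mapping.keys (\<Prod>e\<in>B. var e :: ('e, 'k) mpoly). Poly_Mapping.keys m \<notin> BC)"
      using broken_circuit_monomials_in_carrier finite_broken_circuit[OF B]
      by (auto simp: prod_var keys_squarefree_monomial broken_circuit_complex_def)
  qed
  show "?J \<subseteq> ?I"
  proof
    fix p assume p: "p \<in> ?J"
    have monom: "Poly_Mapping.single m c \<in> ?I" if m: "m \<in> Poly_Mapping.keys p" for m c
    proof -
      have mE: "Poly_Mapping.keys m \<subseteq> edges G" using p m by (auto simp: poly_ring_def)
      moreover have "Poly_Mapping.keys m \<notin> BC" using p m by blast
      ultimately obtain B where B: "broken_circuit G ord B" "B \<subseteq> Poly_Mapping.keys m"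
        using BC_iff by blast
      have finB: "finite B" using finite_broken_circuit[OF B(1)] .
      let ?s = "squarefree_monomial B"
      \<comment> \<open>The cofactor \<open>m - ?s\<close> is a true quotient since \<open>B\<close>
        lies in the support of \<open>m\<close>.\<close>
      have split: "m - ?s + ?s = m"
      proof (rule poly_mapping_eqI)
        fix e
        have "e \<in> B \<Longrightarrow> Poly_Mapping.lookup m e > 0" using B(2) by (auto simp: in_keys_iff)
        then show "Poly_Mapping.lookup (m - ?s + ?s) e = Poly_Mapping.lookup m e"
          by (auto simp: lookup_add lookup_minus lookup_squarefree_monomial[OF finB])
      qed
      then have "Poly_Mapping.keys (m - ?s) \<subseteq> edges G"
        using mE keys_plus_nat[of "m - ?s" ?s] by auto
      then have "Poly_Mapping.single (m - ?s) c \<in> carrier ?R"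
        by (auto simp: poly_ring_def)
      from I.I_l_closed[OF gens[OF B(1)] this] show ?thesis
        using split by (simp add: poly_ring_def prod_var[OF finB] mult_single)
    qed
    have "(\<Sum>m\<in>A. Poly_Mapping.single m (Poly_Mapping.lookup p m)) \<in> ?I"
      if "finite A" "A \<subseteq> Poly_Mapping.keys p" for A
      using that
    proof (induction A rule: finite_induct)
      case empty
      show ?case using I.zero_closed by (simp add: poly_ring_def)
    next
      case (insert m A)
      have "Poly_Mapping.single m (Poly_Mapping.lookup p m) \<in> ?I" using monom insert.prems by blast
      moreover have "(\<Sum>m\<in>A. Poly_Mapping.single m (Poly_Mapping.lookup p m)) \<in> ?I"
        using insert by blast
      ultimately show ?case
        using I.a_closed insert.hyps by (simp add: poly_ring_def)
    qed
    from this[OF finite_keys order_refl] show "p \<in> ?I"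
      by (simp add: poly_mapping_sum_singles)
  qed
qed

lemma bc_proj_eq: "bc_proj G ord p = (\<lambda>h. h + p) ` (bc_ideal G ord :: ('e, 'k::field) mpoly set)"
  by (auto simp: bc_proj_def a_r_coset_def' poly_ring_def)

lemma bc_proj_eq_iff:
  fixes p q :: "('e, 'k::field) mpoly"
  shows "bc_proj G ord p = bc_proj G ord q \<longleftrightarrow> p - q \<in> bc_ideal G ord"
proof
  have zero: "0 \<in> (bc_ideal G ord :: ('e, 'k) mpoly set)"
    by (simp add: bc_ideal_eq poly_ring_def)
  assume "bc_proj G ord p = bc_proj G ord q"
  moreover have "p \<in> bc_proj G ord p" using zero by (force simp: bc_proj_eq)
  ultimately obtain h where "h \<in> bc_ideal G ord" "p = h + q" by (auto simp: bc_proj_eq)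
  then show "p - q \<in> bc_ideal G ord" by simp
next
  assume pq: "p - q \<in> bc_ideal G ord"
  have add: "h + (p - q) \<in> bc_ideal G ord" and diff: "h - (p - q) \<in> bc_ideal G ord"
    if "h \<in> bc_ideal G ord" for h
  proof -
    have "h + g \<in> bc_ideal G ord" "h - g \<in> bc_ideal G ord" if "g \<in> bc_ideal G ord" for g
      using that \<open>h \<in> _\<close>
      by (auto simp: bc_ideal_eq poly_ring_def
          dest!: subsetD[OF Poly_Mapping.keys_add] subsetD[OF Poly_Mapping.keys_diff])
    then show "h + (p - q) \<in> bc_ideal G ord" "h - (p - q) \<in> bc_ideal G ord"
      using pq by blast+
  qed
  show "bc_proj G ord p = bc_proj G ord q"
    unfolding bc_proj_eq
  proof (intro equalityI image_subsetI)
    fix h :: "('e, 'k) mpoly" assume h: "h \<in> bc_ideal G ord"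
    show "h + p \<in> (\<lambda>h. h + q) ` bc_ideal G ord"
      by (rule image_eqI[OF _ add[OF h]]) simp
    show "h + q \<in> (\<lambda>h. h + p) ` bc_ideal G ord"
      by (rule image_eqI[OF _ diff[OF h]]) simp
  qed
qed

section \<open>The quotient ring and its field of scalars\<close>

lemma ring_bc_ring: "ring (bc_ring G ord :: ('e, 'k::field) mpoly set ring)"
  unfolding bc_ring_def by (rule ideal.quotient_is_ring[OF ideal_bc_ideal])

lemma bc_proj_hom:
  "bc_proj G ord \<in> ring_hom (poly_ring (edges G) :: ('e, 'k::field) mpoly ring) (bc_ring G ord)"
proof -
  have "bc_proj G ord = (+>\<^bsub>poly_ring (edges G)\<^esub>) (bc_ideal G ord :: ('e, 'k) mpoly set)"
    by (simp add: fun_eq_iff bc_proj_def)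
  then show ?thesis
    unfolding bc_ring_def using ideal.rcos_ring_hom[OF ideal_bc_ideal] by metis
qed

lemma zero_bc_ring: "\<zero>\<^bsub>bc_ring G ord\<^esub> = bc_proj G ord (0 :: ('e, 'k::field) mpoly)"
  by (simp add: bc_ring_def FactRing_def bc_proj_eq)

lemma one_bc_ring: "\<one>\<^bsub>bc_ring G ord\<^esub> = bc_proj G ord (1 :: ('e, 'k::field) mpoly)"
  by (simp add: bc_ring_def FactRing_def bc_proj_def poly_ring_def)

lemma const_in_carrier: "const c \<in> carrier (poly_ring E)"
  by (simp add: const_def poly_ring_def)

text \<open>The scalars are the image of \<open>field_ring\<close> under a ring homomorphism, and
  such an image is a subfield as soon as 1 and 0 differ in the quotient. They differ because the
  support of the monomial 1 is the empty face.\<close>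

lemma subfield_bc_scalars:
  "subfield (bc_scalars G ord) (bc_ring G ord :: ('e, 'k::field) mpoly set ring)"
proof -
  let ?Q = "bc_ring G ord :: ('e, 'k) mpoly set ring"
  have "const \<in> ring_hom (field_ring :: 'k ring) (poly_ring (edges G))"
    by (rule ring_hom_memI)
      (auto simp: field_ring_def poly_ring_def const_def mult_single single_add)
  then have "bc_proj G ord \<circ> const \<in> ring_hom (field_ring :: 'k ring) ?Q"
    using bc_proj_hom by (rule ring_hom_trans)
  then interpret h: ring_hom_ring "field_ring :: 'k ring" ?Q "bc_proj G ord \<circ> const"
    by (rule ring_hom_ringI2[OF field.is_ring[OF field_field_ring] ring_bc_ring])
  have "(1 :: ('e, 'k) mpoly) \<notin> bc_ideal G ord"
    using empty_in_BC by (auto simp: bc_ideal_eq)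
  then have "\<one>\<^bsub>?Q\<^esub> \<noteq> \<zero>\<^bsub>?Q\<^esub>"
    unfolding zero_bc_ring one_bc_ring bc_proj_eq_iff by simp
  moreover have "subfield (carrier field_ring) (field_ring :: 'k ring)"
    by (rule field.carrier_is_subfield[OF field_field_ring])
  ultimately have "subfield ((bc_proj G ord \<circ> const) ` carrier field_ring) ?Q"
    by (intro h.img_is_subfield)
  then show ?thesis
    by (simp add: bc_scalars_def field_ring_def image_comp)
qed

section \<open>Monomial bases of the graded components\<close>

lemma bc_ring_linear_combination:
  fixes p :: "('e, 'k::field) mpoly"
  assumes "Poly_Mapping.keys m \<subseteq> edges G" "p \<in> carrier (poly_ring (edges G))"
  shows "bc_proj G ord (const c) \<otimes>\<^bsub>bc_ring G ord\<^esub> bc_proj G ord (Poly_Mapping.single m 1)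
      \<oplus>\<^bsub>bc_ring G ord\<^esub> bc_proj G ord p
    = bc_proj G ord (Poly_Mapping.single m c + p)"
proof -
  let ?R = "poly_ring (edges G) :: ('e, 'k) mpoly ring"
  interpret R: cring ?R by (rule cring_poly_ring)
  have m: "Poly_Mapping.single m 1 \<in> carrier ?R" using assms(1) by (simp add: poly_ring_def)
  have c: "const c \<in> carrier ?R" by (rule const_in_carrier)
  have "bc_proj G ord (const c \<otimes>\<^bsub>?R\<^esub> Poly_Mapping.single m 1 \<oplus>\<^bsub>?R\<^esub> p)
      = bc_proj G ord (const c) \<otimes>\<^bsub>bc_ring G ord\<^esub> bc_proj G ord (Poly_Mapping.single m 1)
        \<oplus>\<^bsub>bc_ring G ord\<^esub> bc_proj G ord p"
    using ring_hom_add[OF bc_proj_hom R.m_closed[OF c m] assms(2)] ring_hom_mult[OF bc_proj_hom c m]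
    by simp
  then show ?thesis by (simp add: poly_ring_def const_def mult_single)
qed

text \<open>\<open>Span\<close> grows along the list by \<open>line_extension\<close>, one scalar
  multiple at a time, so the induction splits off the term of the head monomial.\<close>

lemma Span_monomials:
  assumes "\<And>m. m \<in> set ms \<Longrightarrow> Poly_Mapping.keys m \<subseteq> edges G"
  shows "ring.Span (bc_ring G ord) (bc_scalars G ord)
      (map (\<lambda>m. bc_proj G ord (Poly_Mapping.single m 1)) ms)
    = bc_proj G ord ` {p :: ('e, 'k::field) mpoly. Poly_Mapping.keys p \<subseteq> set ms}"
  using assms
proof (induction ms)
  interpret Q: ring "bc_ring G ord :: ('e, 'k) mpoly set ring" by (rule ring_bc_ring)
  {
    case Nil
    show ?case by (simp add: zero_bc_ring)
  next
    case (Cons m ms)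
    let ?K = "bc_scalars G ord :: ('e, 'k) mpoly set set"
    let ?b = "\<lambda>m. bc_proj G ord (Poly_Mapping.single m (1::'k))"
    let ?P = "\<lambda>ms. {p :: ('e, 'k) mpoly. Poly_Mapping.keys p \<subseteq> set ms}"
    have m: "Poly_Mapping.keys m \<subseteq> edges G" using Cons.prems by simp
    have carr: "p \<in> carrier (poly_ring (edges G))" if "p \<in> ?P ms" for p
      using that Cons.prems by (fastforce simp: poly_ring_def)
    have "Q.Span ?K (map ?b (m # ms)) = Q.line_extension ?K (?b m) (bc_proj G ord ` ?P ms)"
      using Cons by simp
    also have "\<dots> = bc_proj G ord ` ?P (m # ms)"
    proof (intro equalityI subsetI)
      fix x assume "x \<in> Q.line_extension ?K (?b m) (bc_proj G ord ` ?P ms)"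
      then obtain c p where p: "p \<in> ?P ms" and
        x: "x = bc_proj G ord (const c) \<otimes>\<^bsub>bc_ring G ord\<^esub> ?b m \<oplus>\<^bsub>bc_ring G ord\<^esub> bc_proj G ord p"
        by (auto simp: Q.line_extension_mem_iff bc_scalars_def)
      have "x = bc_proj G ord (Poly_Mapping.single m c + p)"
        unfolding x by (rule bc_ring_linear_combination[OF m carr[OF p]])
      moreover have "Poly_Mapping.single m c + p \<in> ?P (m # ms)"
        using p Poly_Mapping.keys_add[of "Poly_Mapping.single m c" p]
        by (auto split: if_splits)
      ultimately show "x \<in> bc_proj G ord ` ?P (m # ms)" by blast
    next
      fix x assume "x \<in> bc_proj G ord ` ?P (m # ms)"
      then obtain p where p: "p \<in> ?P (m # ms)" and x: "x = bc_proj G ord p" by blast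
      define c where "c = Poly_Mapping.lookup p m"
      define p' where "p' = p - Poly_Mapping.single m c"
      have p': "p' \<in> ?P ms"
      proof
        show "Poly_Mapping.keys p' \<subseteq> set ms"
        proof
          fix k assume "k \<in> Poly_Mapping.keys p'"
          then have "Poly_Mapping.lookup p k \<noteq> 0" "k \<noteq> m"
            by (auto simp: p'_def c_def in_keys_iff lookup_minus lookup_single when_def split: if_splits)
          then show "k \<in> set ms" using p by (auto simp: in_keys_iff)
        qed
      qed
      have "bc_proj G ord (const c) \<otimes>\<^bsub>bc_ring G ord\<^esub> ?b m \<oplus>\<^bsub>bc_ring G ord\<^esub> bc_proj G ord p'
          = bc_proj G ord (Poly_Mapping.single m c + p')"
        by (rule bc_ring_linear_combination[OF m carr[OF p']])
      then have "x = bc_proj G ord (const c) \<otimes>\<^bsub>bc_ring G ord\<^esub> ?b m \<oplus>\<^bsub>bc_ring G ord\<^esub> bc_proj G ord p'"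
        by (simp add: x p'_def)
      then show "x \<in> Q.line_extension ?K (?b m) (bc_proj G ord ` ?P ms)"
        using p' unfolding Q.line_extension_mem_iff bc_scalars_def by blast
    qed
    finally show ?case .
  }
qed

text \<open>If the head monomial were congruent to a combination of the others, their difference
  would lie in the ideal and still contain \<open>m\<close>, although no monomial of a member of the
  ideal has a face as its support.\<close>

lemma independent_monomials:
  assumes "distinct ms" "\<And>m. m \<in> set ms \<Longrightarrow> Poly_Mapping.keys m \<in> BC"
  shows "ring.independent (bc_ring G ord) (bc_scalars G ord)
    (map (\<lambda>m. bc_proj G ord (Poly_Mapping.single m (1::'k::field))) ms)"
  using assms
proof (induction ms)
  interpret Q: ring "bc_ring G ord :: ('e, 'k) mpoly set ring" by (rule ring_bc_ring)
  {
    case Nil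
    show ?case by simp
  next
    case (Cons m ms)
    let ?K = "bc_scalars G ord :: ('e, 'k) mpoly set set"
    let ?b = "\<lambda>m. bc_proj G ord (Poly_Mapping.single m (1::'k))"
    have edges: "Poly_Mapping.keys m' \<subseteq> edges G" if "m' \<in> set (m # ms)" for m'
      using Cons.prems(2)[OF that] by (rule BC_subset_edges)
    have "?b m \<in> carrier (bc_ring G ord)"
      using edges by (intro ring_hom_closed[OF bc_proj_hom]) (simp add: poly_ring_def)
    moreover have "?b m \<notin> Q.Span ?K (map ?b ms)"
    proof
      assume "?b m \<in> Q.Span ?K (map ?b ms)"
      also have "Q.Span ?K (map ?b ms)
          = bc_proj G ord ` {p :: ('e, 'k) mpoly. Poly_Mapping.keys p \<subseteq> set ms}"
        using edges by (intro Span_monomials) auto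
      finally obtain p where p: "Poly_Mapping.keys p \<subseteq> set ms"
        and "?b m = bc_proj G ord p" by blast
      then have "Poly_Mapping.single m 1 - p \<in> bc_ideal G ord"
        by (simp add: bc_proj_eq_iff)
      moreover have "m \<notin> Poly_Mapping.keys p" using p Cons.prems(1) by auto
      then have "m \<in> Poly_Mapping.keys (Poly_Mapping.single m 1 - p)"
        by (simp add: in_keys_iff lookup_minus)
      ultimately show False using Cons.prems(2)[of m] by (auto simp: bc_ideal_eq)
    qed
    moreover have "Q.independent ?K (map ?b ms)" using Cons by simp
    ultimately show ?case by (simp add: Q.li_Cons)
  }
qed

text \<open>Terms whose support is a nonface lie in the ideal, so deleting them from a homogeneous
  polynomial does not change its class.\<close>

lemma bc_component_eq:
  "(bc_component G ord d :: ('e, 'k::field) mpoly set set) = bc_proj G ord ` {p.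
    Poly_Mapping.keys p \<subseteq> {m. Poly_Mapping.keys m \<in> BC \<and> monomial_degree m = d}}"
  (is "_ = bc_proj G ord ` ?P")
proof
  show "bc_proj G ord ` ?P \<subseteq> bc_component G ord d"
    unfolding bc_component_def
    by (intro image_mono) (use BC_subset_edges in \<open>fastforce simp: homogeneous_part_def poly_ring_def\<close>)
  show "bc_component G ord d \<subseteq> bc_proj G ord ` ?P"
    unfolding bc_component_def
  proof
    fix x :: "('e, 'k) mpoly set"
    assume "x \<in> bc_proj G ord ` homogeneous_part (edges G) d"
    then obtain p :: "('e, 'k) mpoly" where p: "p \<in> homogeneous_part (edges G) d"
      and x: "x = bc_proj G ord p" by blast
    define p' where "p' = (\<Sum>m\<in>{m \<in> Poly_Mapping.keys p. Poly_Mapping.keys m \<in> BC}.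
      Poly_Mapping.single m (Poly_Mapping.lookup p m))"
    have lookup: "Poly_Mapping.lookup p' m
        = (if Poly_Mapping.keys m \<in> BC then Poly_Mapping.lookup p m else 0)" for m
      by (auto simp: p'_def lookup_sum lookup_single when_def in_keys_iff)
    have "p' \<in> ?P"
      using p by (auto simp: lookup in_keys_iff homogeneous_part_def split: if_splits)
    moreover have "p - p' \<in> bc_ideal G ord"
      using p by (auto simp: bc_ideal_eq poly_ring_def homogeneous_part_def in_keys_iff
          lookup_minus lookup split: if_splits)
    then have "x = bc_proj G ord p'" by (simp add: x bc_proj_eq_iff)
    ultimately show "x \<in> bc_proj G ord ` ?P" by blast
  qed
qed

lemma dim_bc_component:
  "ring.dim (bc_ring G ord :: ('e, 'k::field) mpoly set ring) (bc_scalars G ord) (bc_component G ord d)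
    = card {m. Poly_Mapping.keys m \<in> BC \<and> monomial_degree m = d}"
proof -
  interpret Q: ring "bc_ring G ord :: ('e, 'k) mpoly set ring" by (rule ring_bc_ring)
  let ?S = "{m. Poly_Mapping.keys m \<in> BC \<and> monomial_degree m = d}"
  have "finite ?S"
    by (rule finite_subset[OF _ finite_monomials[OF finite_edges, of d]])
      (auto dest: BC_subset_edges)
  then obtain ms where ms: "set ms = ?S" "distinct ms"
    using finite_distinct_list by blast
  let ?Us = "map (\<lambda>m. bc_proj G ord (Poly_Mapping.single m (1::'k))) ms"
  have "Q.dimension (length ?Us) (bc_scalars G ord) (bc_component G ord d)"
  proof (rule Q.dimensionI[OF subfield_bc_scalars])
    show "Q.independent (bc_scalars G ord) ?Us"
      using ms by (intro independent_monomials) auto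
    have "Poly_Mapping.keys m \<subseteq> edges G" if "m \<in> set ms" for m
      using that ms(1) by (auto dest: BC_subset_edges)
    then show "Q.Span (bc_scalars G ord) ?Us = bc_component G ord d"
      unfolding bc_component_eq ms(1)[symmetric] by (rule Span_monomials)
  qed
  then have "Q.dim (bc_scalars G ord) (bc_component G ord d) = length ?Us"
    using Q.dimI[OF subfield_bc_scalars] by (simp add: over_def)
  then show ?thesis using ms distinct_card[OF ms(2)] by simp
qed

theorem bc_hilbert_series_faces:
  "bc_hilbert_series TYPE('k::field) G ord = (\<Sum>F\<in>BC. (fps_X * inverse (1 - fps_X)) ^ card F)"
proof -
  have fin: "finite F" if "F \<in> BC" for F
    using BC_subset_edges[OF that] finite_edges finite_subset by blast
  have fin': "finite {m. Poly_Mapping.keys m = F \<and> monomial_degree m = d}" if "F \<in> BC" for F d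
    by (rule finite_subset[OF _ finite_monomials[OF fin[OF that], of d]]) auto
  have "card {m. Poly_Mapping.keys m \<in> BC \<and> monomial_degree m = d}
      = (\<Sum>F\<in>BC. card {m. Poly_Mapping.keys m = F \<and> monomial_degree m = d})" for d
  proof -
    have "{m. Poly_Mapping.keys m \<in> BC \<and> monomial_degree m = d}
        = (\<Union>F\<in>BC. {m. Poly_Mapping.keys m = F \<and> monomial_degree m = d})" by auto
    then show ?thesis
      using finite_BC fin' by (simp only:) (subst card_UN_disjoint, auto)
  qed
  then have "bc_hilbert_series TYPE('k) G ord = (\<Sum>F\<in>BC.
      Abs_fps (\<lambda>d. of_nat (card {m. Poly_Mapping.keys m = F \<and> monomial_degree m = d})))"
    by (simp add: bc_hilbert_series_def fps_eq_iff fps_sum_nth dim_bc_component)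
  also have "\<dots> = (\<Sum>F\<in>BC. (fps_X * inverse (1 - fps_X)) ^ card F)"
    by (intro sum.cong refl monomials_generating_function fin)
  finally show ?thesis .
qed

end

section \<open>Face sums for the h-polynomial, the Hilbert series and the colour count\<close>

context ordered_graph
begin

text \<open>The bound ensures that the exponents \<open>card (verts G) - 1 - card F\<close> below
  are true differences.\<close>

lemma BC_card_less:
  assumes "F \<in> BC" "verts G \<noteq> {}"
  shows "card F < card (verts G)"
  using card_forest_less[OF BC_subset_edges BC_acyclic] assms by blast

lemma sum_BC_card:
  fixes g :: "nat \<Rightarrow> 'a::comm_semiring_1"
  assumes "verts G \<noteq> {}"
  shows "(\<Sum>i=0..card (verts G) - 1. of_nat (face_number G ord i) * g i) = (\<Sum>F\<in>BC. g (card F))"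
proof -
  have "(\<Sum>F\<in>BC. g (card F))
      = (\<Sum>i=0..card (verts G) - 1. \<Sum>F\<in>{F \<in> BC. card F = i}. g (card F))"
    using BC_card_less[OF _ assms] finite_BC by (intro sum.group[symmetric]) fastforce+
  also have "\<dots> = (\<Sum>i=0..card (verts G) - 1. of_nat (face_number G ord i) * g i)"
    by (intro sum.cong refl) (simp add: face_number_def)
  finally show ?thesis by simp
qed

lemma h_polynomial_faces:
  assumes "verts G \<noteq> {}"
  shows "h_polynomial G ord = (\<Sum>F\<in>BC. [:0, 1:] ^ card F * [:1, -1:] ^ (card (verts G) - 1 - card F))"
  using sum_BC_card[OF assms, of "\<lambda>i. [:0, 1:] ^ i * [:1, -1:] ^ (card (verts G) - 1 - i)"]
  by (simp add: h_polynomial_def Let_def mult.assoc)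

text \<open>The power of \<open>1 - fps_X\<close> clears the denominators of all faces at once,
  because \<open>card F\<close> never exceeds its exponent.\<close>

lemma bc_hilbert_series_mult:
  assumes "verts G \<noteq> {}"
  shows "(1 - fps_X) ^ (card (verts G) - 1) * bc_hilbert_series TYPE('k::field) G ord
    = (\<Sum>F\<in>BC. fps_X ^ card F * (1 - fps_X) ^ (card (verts G) - 1 - card F))"
proof -
  define r where "r = card (verts G) - 1"
  have unit: "(1 - fps_X) * inverse (1 - fps_X) = (1 :: rat fps)"
    by (rule inverse_mult_eq_1') simp
  have "(1 - fps_X) ^ r * (fps_X * inverse (1 - fps_X)) ^ card F
      = fps_X ^ card F * (1 - fps_X :: rat fps) ^ (r - card F)" if "F \<in> BC" for F
  proof -
    have "card F \<le> r" using BC_card_less[OF that assms] by (simp add: r_def)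
    then have "(1 - fps_X :: rat fps) ^ r = (1 - fps_X) ^ (r - card F) * (1 - fps_X) ^ card F"
      by (simp flip: power_add)
    then have "(1 - fps_X) ^ r * (fps_X * inverse (1 - fps_X)) ^ card F
      = fps_X ^ card F * (1 - fps_X :: rat fps) ^ (r - card F)
        * ((1 - fps_X) * inverse (1 - fps_X)) ^ card F"
      by (simp add: power_mult_distrib mult_ac)
    then show ?thesis by (simp add: unit)
  qed
  then show ?thesis
    by (simp add: bc_hilbert_series_faces sum_distrib_left r_def)
qed

text \<open>A forest has fewer edges than vertices, so its colouring count is divisible by
  \<open>q\<close>; extracting this factor leaves the exponent that occurs in the h-polynomial. The
  general target ring allows the identity to be used over the rationals.\<close>

lemma whitney_power:
  assumes "verts G \<noteq> {}" "q > 0"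
  shows "of_nat q * (\<Sum>F\<in>BC. (-1) ^ card F * of_nat q ^ (card (verts G) - 1 - card F))
    = (of_nat (card {f \<in> verts G \<rightarrow>\<^sub>E {..<q}. \<forall>e\<in>edges G. \<not> monochromatic G f e}) :: 'a::comm_ring_1)"
proof -
  have "card (colorings G q F) = q * q ^ (card (verts G) - 1 - card F)" if "F \<in> BC" for F
  proof -
    have "card (colorings G q F) * q ^ card F = q ^ card (verts G)"
      by (intro card_colorings_forest BC_subset_edges BC_acyclic that)
    also have "\<dots> = q ^ Suc (card (verts G) - 1 - card F) * q ^ card F"
      using BC_card_less[OF that assms(1)] by (simp flip: power_add power_Suc)
    finally show ?thesis using assms(2) by simp
  qed
  then have "(\<Sum>F\<in>BC. (-1) ^ card F * int (card (colorings G q F)))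
      = int q * (\<Sum>F\<in>BC. (-1) ^ card F * int q ^ (card (verts G) - 1 - card F))"
    by (simp add: sum_distrib_left mult_ac)
  then have "int q * (\<Sum>F\<in>BC. (-1) ^ card F * int q ^ (card (verts G) - 1 - card F))
      = int (card {f \<in> verts G \<rightarrow>\<^sub>E {..<q}. \<forall>e\<in>edges G. \<not> monochromatic G f e})"
    by (simp only: whitney_broken_circuit)
  from arg_cong[OF this, of "of_int :: int \<Rightarrow> 'a"] show ?thesis by simp
qed

end


section \<open>Cycle counts of permutations\<close>

text \<open>\<open>orbit\<close> collects images under positive iterates only; a permutation of a
  finite set returns to its start, which makes orbits symmetric.\<close>

lemma permutes_orbit_eq:
  assumes "finite S" "p permutes S" "y \<in> orbit p x"
  shows "orbit p y = orbit p x"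
proof -
  have perm: "permutation p" using assms permutation_permutes by blast
  then have "x \<in> orbit p y"
    using assms(3) by (rule orbit_swap[OF permutation_self_in_orbit])
  then show ?thesis using assms(3) by (blast intro: orbit_trans)
qed

lemma card_orbits_insert_fixed:
  assumes "finite S" "p permutes S" "a \<notin> S"
  shows "card (orbit p ` insert a S) = Suc (card (orbit p ` S))"
proof -
  have a: "orbit p a = {a}"
    using assms by (simp add: orbit_eq_singleton_iff permutes_not_in)
  have "orbit p x \<subseteq> S" if "x \<in> S" for x
    using permutes_orbit_subset[OF assms(2) that] .
  then have "orbit p a \<notin> orbit p ` S" using a assms(3) by auto
  then show ?thesis using assms(1) by simp
qed

text \<open>Composing with the transposition inserts \<open>a\<close> into the cycle of
  \<open>b\<close>, immediately before \<open>b\<close>. Cutting the new orbits back to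
  \<open>S\<close> recovers the old ones.\<close>

lemma card_orbits_transpose:
  assumes "finite S" and p: "p permutes S" and a: "a \<notin> S" and b: "b \<in> S"
  defines "q \<equiv> transpose a b \<circ> p"
  shows "card (orbit q ` insert a S) = card (orbit p ` S)"
proof -
  have pS: "p x \<in> S" if "x \<in> S" for x using that permutes_in_image[OF p] by blast
  have q_a: "q a = b" using permutes_not_in[OF p a] by (simp add: q_def)
  have q_S: "q x = (if p x = b then a else p x)" if "x \<in> S" for x
    using pS[OF that] a by (auto simp: q_def transpose_def)
  have q: "q permutes insert a S"
    unfolding q_def using p b
    by (intro permutes_compose permutes_swap_id permutes_subset[OF p]) auto
  have fin: "finite (insert a S)" using assms(1) by simp
  \<comment> \<open>One step of \<open>p\<close> is one step of \<open>q\<close>, or two steps by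
    way of \<open>a\<close> when it ends in \<open>b\<close>.\<close>
  have forward: "y \<in> orbit q x" if "y \<in> orbit p x" "x \<in> S" for x y
  proof -
    have step: "p z \<in> orbit q z" if "z \<in> S" for z
    proof (cases "p z = b")
      case True
      then have "q (q z) = p z" using q_S[OF that] q_a by simp
      moreover have "q (q z) \<in> orbit q z" by (intro orbit.intros)
      ultimately show ?thesis by simp
    next
      case False
      then have "q z = p z" using q_S[OF that] by simp
      then show ?thesis using orbit.base[of q z] by simp
    qed
    have "y \<in> S \<and> y \<in> orbit q x" using that(1)
    proof induction
      case base
      then show ?case using step pS that(2) by blast
    next
      case (step y)
      then show ?case using \<open>\<And>z. z \<in> S \<Longrightarrow> p z \<in> orbit q z\<close> pS by (blast intro: orbit_trans)
    qed
    then show ?thesis by blast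
  qed
  \<comment> \<open>The case \<open>y = a\<close> must remember that \<open>b\<close> lies in the
    orbit of \<open>p\<close>, since the next step of \<open>q\<close> goes from \<open>a\<close> to
    \<open>b\<close>.\<close>
  have backward: "y \<in> S \<and> y \<in> orbit p x \<or> y = a \<and> b \<in> orbit p x"
    if "y \<in> orbit q x" "x \<in> S" for x y
    using that(1)
  proof induction
    case base
    then show ?case using q_S[OF that(2)] pS[OF that(2)] orbit.base[of p x] by auto
  next
    case (step y)
    then show ?case using q_S[of y] q_a b pS[of y] orbit.step[of y p x] by auto
  qed
  have restrict: "orbit q x \<inter> S = orbit p x" if "x \<in> S" for x
  proof (intro equalityI subsetI)
    show "y \<in> orbit p x" if "y \<in> orbit q x \<inter> S" for y
      using backward[of y x] that \<open>x \<in> S\<close> a by auto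
    show "y \<in> orbit q x \<inter> S" if "y \<in> orbit p x" for y
      using forward[OF that \<open>x \<in> S\<close>] permutes_orbit_subset[OF p \<open>x \<in> S\<close>] that by auto
  qed
  have "orbit q b = orbit q a"
    using permutes_orbit_eq[OF fin q orbit.base[of q a]] q_a by simp
  then have "orbit q ` insert a S = orbit q ` S" using b by auto
  moreover have "inj_on (\<lambda>T. T \<inter> S) (orbit q ` S)"
  proof (rule inj_onI, clarsimp)
    fix x y assume xy: "x \<in> S" "y \<in> S" "orbit q x \<inter> S = orbit q y \<inter> S"
    have "permutation q" using q fin permutation_permutes by blast
    then have "x \<in> orbit q x" by (rule permutation_self_in_orbit)
    then have "x \<in> orbit q y" using xy by blast
    then show "orbit q x = orbit q y" using permutes_orbit_eq[OF fin q] by blast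
  qed
  moreover have "(\<lambda>T. T \<inter> S) ` orbit q ` S = orbit p ` S"
    using restrict by (simp add: image_image)
  ultimately show ?thesis using card_image by metis
qed

text \<open>Every permutation of \<open>insert a S\<close> is uniquely \<open>transpose a b\<close>
  after a permutation of \<open>S\<close>. The choice \<open>b = a\<close> leaves \<open>a\<close>
  as an orbit of its own, and each of the \<open>card S\<close> other choices keeps the number of
  orbits; this is the Stirling recurrence.\<close>

lemma card_permutes_orbits_insert:
  assumes "finite S" "a \<notin> S"
  shows "card {p. p permutes insert a S \<and> card (orbit p ` insert a S) = Suc k}
    = card S * card {p. p permutes S \<and> card (orbit p ` S) = Suc k}
      + card {p. p permutes S \<and> card (orbit p ` S) = k}"
proof -
  define P where "P = (\<lambda>k. {p. p permutes S \<and> card (orbit p ` S) = k})"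
  define T where "T = (\<lambda>(b, p). transpose a b \<circ> p :: 'a \<Rightarrow> 'a)"
  define Z where "Z = S \<times> P (Suc k) \<union> {a} \<times> P k"
  have orbits: "card (orbit (T (b, p)) ` insert a S)
      = (if b = a then Suc (card (orbit p ` S)) else card (orbit p ` S))"
    if "p permutes S" "b \<in> insert a S" for b p
    using that assms card_orbits_insert_fixed[OF assms(1) that(1) assms(2)]
      card_orbits_transpose[OF assms(1) that(1) assms(2)]
    by (auto simp: T_def)
  have "{p. p permutes insert a S \<and> card (orbit p ` insert a S) = Suc k} = T ` Z"
    (is "?L = _")
  proof (intro equalityI subsetI)
    fix p' assume p': "p' \<in> ?L"
    then have "p' \<in> T ` {(b, p). b \<in> insert a S \<and> p \<in> {p. p permutes S}}"
      using permutes_insert[of a S] by (auto simp: T_def)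
    then obtain b p where bp: "b \<in> insert a S" "p permutes S" "p' = T (b, p)" by auto
    then have "(b, p) \<in> Z"
      using p' orbits[OF bp(2,1)] assms(2) by (auto simp: Z_def P_def split: if_splits)
    then show "p' \<in> T ` Z" using bp by blast
  next
    fix p' assume "p' \<in> T ` Z"
    then obtain b p where bp: "(b, p) \<in> Z" "p' = T (b, p)" by auto
    then have "b \<in> insert a S" "p permutes S" by (auto simp: Z_def P_def)
    moreover from this have "p' permutes insert a S"
      using permutes_insert[of a S] bp(2) by (auto simp: T_def)
    ultimately show "p' \<in> ?L"
      using orbits[of p b] bp assms(2) by (auto simp: Z_def P_def)
  qed
  \<comment> \<open>Since \<open>p\<close> fixes \<open>a\<close>, the image of \<open>a\<close>
    under the composite reveals \<open>b\<close>.\<close>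
  moreover have "inj_on T Z"
  proof (rule inj_onI, clarify)
    fix b p b' p' assume *: "(b, p) \<in> Z" "(b', p') \<in> Z" "T (b, p) = T (b', p')"
    then have "p a = a" "p' a = a" using assms(2) by (auto simp: Z_def P_def permutes_not_in)
    moreover have "T (b, p) a = T (b', p') a" using * by simp
    ultimately have "b = b'" by (simp add: T_def)
    moreover from this have "transpose a b \<circ> (transpose a b \<circ> p) = transpose a b \<circ> (transpose a b \<circ> p')"
      using * by (simp add: T_def)
    then have "p = p'" by (simp add: o_assoc[symmetric] fun_eq_iff)
    ultimately show "b = b' \<and> p = p'" by simp
  qed
  ultimately have "card ?L = card Z" by (simp add: card_image)
  moreover have "finite (P k)" for k
    using finite_permutations[OF assms(1)] by (simp add: P_def)
  then have "card Z = card S * card (P (Suc k)) + card (P k)"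
    unfolding Z_def using assms by (subst card_Un_disjoint) (auto simp: card_cartesian_product)
  ultimately show ?thesis by (simp add: P_def)
qed

section \<open>Stirling numbers as coefficients of a product\<close>

lemma stirling_first_eq_stirling: "stirling_first n k = stirling n k"
proof (induction n arbitrary: k)
  case 0
  show ?case by (cases k) (auto simp: stirling_first_def)
next
  case (Suc n)
  have ins: "{..<Suc n} = insert n {..<n}" by auto
  show ?case
  proof (cases k)
    case 0
    have "\<not> (p permutes {..<Suc n} \<and> card (orbit p ` {..<Suc n}) = 0)" for p
      by auto
    then show ?thesis by (simp add: stirling_first_def 0)
  next
    case (Suc k')
    then show ?thesis
      using card_permutes_orbits_insert[of "{..<n}" n k'] Suc.IH[unfolded stirling_first_def]
      by (simp add: stirling_first_def ins)
  qed
qed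

text \<open>A new factor 1 + m z replaces the coefficient c_i by c_i + m c_(i-1); reading the index
  from the top, as m - i, turns this into the Stirling recurrence. For positive \<open>m\<close> the
  case \<open>i = m\<close> lies above the degree, in accordance with
  \<open>stirling m 0 = 0\<close>.\<close>

lemma coeff_prod_stirling:
  assumes "i \<le> m"
  shows "coeff (\<Prod>j=1..<m. [:1, of_nat j:] :: int poly) i = of_nat (stirling m (m - i))"
  using assms
proof (induction m arbitrary: i)
  case 0
  then show ?case by simp
next
  case (Suc m)
  show ?case
  proof (cases "m = 0")
    case True
    then show ?thesis using Suc.prems by (cases i) auto
  next
    case False
    let ?p = "\<Prod>j=1..<m. [:1, of_nat j:] :: int poly"
    have "(\<Prod>j=1..<Suc m. [:1, of_nat j:] :: int poly) = ?p * [:1, of_nat m:]"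
      using False by (subst prod.atLeastLessThan_Suc) auto
    also have "\<dots> = ?p + smult (of_nat m) (pCons 0 ?p)"
      by (simp add: mult.commute)
    finally have eq: "coeff (\<Prod>j=1..<Suc m. [:1, of_nat j:] :: int poly) i
      = coeff ?p i + of_nat m * coeff (pCons 0 ?p) i"
      by (simp only: coeff_add coeff_smult)
    \<comment> \<open>For \<open>i = Suc m\<close> the coefficient of \<open>?p\<close> at
      \<open>i\<close> is outside the reach of the induction hypothesis and vanishes by
      degree.\<close>
    have "degree ?p \<le> (\<Sum>j=1..<m. 1)"
      by (rule order_trans[OF degree_prod_sum_le sum_mono]) auto
    then have deg: "degree ?p \<le> m - 1" by simp
    show ?thesis
    proof (cases i)
      case 0
      then show ?thesis using eq Suc.IH[of 0] by simp
    next
      case (Suc k)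
      show ?thesis
      proof (cases "i = Suc m")
        case True
        then show ?thesis unfolding eq using deg False Suc.IH[of m] by (simp add: coeff_eq_0)
      next
        case False
        then have "i \<le> m" using Suc.prems by simp
        then have "Suc m - i = Suc (m - i)" "m - k = Suc (m - i)" using Suc by auto
        then show ?thesis
          unfolding eq using Suc.IH[OF \<open>i \<le> m\<close>] Suc.IH[of k] Suc \<open>i \<le> m\<close> by simp
      qed
    qed
  qed
qed


section \<open>Complete graphs\<close>

text \<open>In a complete graph the proper colourings are the injective ones, whose number is a
  falling factorial. The bound on \<open>q\<close> makes the truncated factors \<open>q - i\<close>
  agree with the differences in the ring.\<close>

lemma card_proper_colorings_complete_graph:
  assumes "finite V" "card V \<le> q"
  shows "of_nat (card {f \<in> V \<rightarrow>\<^sub>E {..<q}. \<forall>e\<in>edges (complete_graph V).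
      \<not> monochromatic (complete_graph V) f e})
    = (\<Prod>i<card V. of_nat q - of_nat i :: 'a::comm_ring_1)"
proof -
  have "(\<forall>e\<in>edges (complete_graph V). \<not> monochromatic (complete_graph V) f e) \<longleftrightarrow> inj_on f V"
    for f :: "'b \<Rightarrow> nat"
  proof
    assume *: "\<forall>e\<in>edges (complete_graph V). \<not> monochromatic (complete_graph V) f e"
    show "inj_on f V"
    proof (rule inj_onI, rule ccontr)
      fix x y assume xy: "x \<in> V" "y \<in> V" "f x = f y" "x \<noteq> y"
      then have "{x, y} \<in> edges (complete_graph V)" by (simp add: complete_graph_def)
      then have "\<not> monochromatic (complete_graph V) f {x, y}" using * by blast
      then show False using xy by (auto simp: complete_graph_def monochromatic_def)
    qed
  next
    assume inj: "inj_on f V"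
    show "\<forall>e\<in>edges (complete_graph V). \<not> monochromatic (complete_graph V) f e"
    proof
      fix e assume "e \<in> edges (complete_graph V)"
      then obtain x y where "e = {x, y}" "x \<noteq> y" "x \<in> V" "y \<in> V"
        by (auto simp: complete_graph_def card_2_iff)
      then show "\<not> monochromatic (complete_graph V) f e"
        using inj by (auto simp: complete_graph_def monochromatic_def dest: inj_onD)
    qed
  qed
  then have "card {f \<in> V \<rightarrow>\<^sub>E {..<q}. \<forall>e\<in>edges (complete_graph V).
      \<not> monochromatic (complete_graph V) f e} = (\<Prod>i<card V. q - i)"
    using card_inj_on_subset_funcset[of V "{..<q}" V] assms(1) by (simp add: atLeast0LessThan)
  moreover have "of_nat (q - i) = (of_nat q - of_nat i :: 'a)" if "i < card V" for i
    using that assms(2) by (simp add: of_nat_diff)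
  ultimately show ?thesis by simp
qed

lemma ordered_graph_complete_graph:
  assumes "finite V" "linear_order_on (edges (complete_graph V)) ord"
  shows "ordered_graph (complete_graph V) ord"
proof unfold_locales
  show "finite (edges (complete_graph V))"
    by (rule finite_subset[of _ "Pow V"]) (auto simp: complete_graph_def assms(1))
qed (use assms in \<open>auto simp: complete_graph_def\<close>)

text \<open>Whitney's theorem evaluates the left-hand side at \<open>-1 / s\<close> through the number of proper
  colourings with \<open>s + 1\<close> colours.\<close>

lemma sum_BC_complete_graph:
  assumes "finite V" "card V = n" "n \<ge> 2" "linear_order_on (edges (complete_graph V)) ord"
  shows "(\<Sum>F\<in>broken_circuit_complex (complete_graph V) ord.
      [:0, 1:] ^ card F * [:1, -1:] ^ (n - 1 - card F))
    = (\<Prod>j=1..n-2. [:1, of_nat j:] :: rat poly)" (is "?H = ?P")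
proof (rule ccontr)
  interpret ordered_graph "complete_graph V" ord
    by (rule ordered_graph_complete_graph) fact+
  have V: "verts (complete_graph V) = V" "V \<noteq> {}" using assms by (auto simp: complete_graph_def)
  define z :: "nat \<Rightarrow> rat" where "z = (\<lambda>s. - 1 / of_nat s)"
  have root: "poly ?H (z s) = poly ?P (z s)" if s: "s \<ge> n" for s
  proof -
    let ?s = "of_nat s :: rat"
    have s0: "?s \<noteq> 0" "?s + 1 \<noteq> 0" using s assms(3) of_nat_0_le_iff[of s, where ?'a = rat] by (auto simp: add_nonneg_eq_0_iff)
    \<comment> \<open>The power of \<open>?s\<close> is shared out between the factors: it turns
      \<open>z s\<close> into -1 and \<open>1 - z s\<close> into \<open>?s + 1\<close>, the number
      of colours.\<close>
    have summand: "?s ^ (n - 1) * (z s ^ card F * (1 - z s) ^ (n - 1 - card F))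
        = (-1) ^ card F * (?s + 1) ^ (n - 1 - card F)" if "F \<in> BC" for F
    proof -
      have "card F \<le> n - 1" using BC_card_less[OF that] V assms(2) by simp
      then have "?s ^ (n - 1) = ?s ^ card F * ?s ^ (n - 1 - card F)"
        by (metis le_add_diff_inverse power_add)
      then have "?s ^ (n - 1) * (z s ^ card F * (1 - z s) ^ (n - 1 - card F))
          = (?s * z s) ^ card F * (?s * (1 - z s)) ^ (n - 1 - card F)"
        by (simp only: power_mult_distrib mult_ac)
      moreover have "?s * z s = -1" "?s * (1 - z s) = ?s + 1"
        using s0 by (simp_all add: z_def field_simps)
      ultimately show ?thesis by simp
    qed
    have "?s ^ (n - 1) * poly ?H (z s)
        = (\<Sum>F\<in>BC. ?s ^ (n - 1) * (z s ^ card F * (1 - z s) ^ (n - 1 - card F)))"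
      by (simp add: poly_sum sum_distrib_left)
    also have "\<dots> = (\<Sum>F\<in>BC. (-1) ^ card F * (?s + 1) ^ (n - 1 - card F))"
      by (intro sum.cong refl summand)
    finally have "(?s + 1) * (?s ^ (n - 1) * poly ?H (z s))
        = (?s + 1) * (\<Sum>F\<in>BC. (-1) ^ card F * (?s + 1) ^ (n - 1 - card F))"
      by simp
    also have "\<dots> = (\<Prod>i<n. (?s + 1) - of_nat i)"
      using whitney_power[of "Suc s", where ?'a = rat] V assms(1,2) s
        card_proper_colorings_complete_graph[of V "Suc s", where ?'a = rat]
      by (simp add: add.commute)
    \<comment> \<open>The factor for \<open>i = 0\<close> is the number of colours and cancels at
      the end; the factor for \<open>i = 1\<close> is \<open>?s\<close> and is split off
      next.\<close>
    also have "\<dots> = (?s + 1) * (\<Prod>i<n - 1. ?s - of_nat i)"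
      using assms(3) by (cases n) (auto simp: prod.lessThan_Suc_shift simp del: prod.lessThan_Suc)
    also have "(\<Prod>i<n - 1. ?s - of_nat i) = ?s * (\<Prod>i<n - 2. ?s - of_nat (Suc i))"
    proof -
      have "n - 1 = Suc (n - 2)" using assms(3) by simp
      then show ?thesis by (simp only: prod.lessThan_Suc_shift) simp
    qed
    also have "(\<Prod>i<n - 2. ?s - of_nat (Suc i)) = (\<Prod>j=1..n-2. ?s - of_nat j)"
      by (rule prod.reindex_bij_witness[of _ "\<lambda>j. j - 1" Suc]) auto
    \<comment> \<open>As \<open>?s * z s = -1\<close>, these factors are those of \<open>?P\<close>
      at \<open>z s\<close>, each scaled by \<open>?s\<close>; the \<open>n - 2\<close> copies of
      \<open>?s\<close> and the one split off before make up the power \<open>n - 1\<close>.\<close>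
    also have "\<dots> = (\<Prod>j=1..n-2. ?s * (1 + of_nat j * z s))"
      using s0 by (intro prod.cong) (simp_all add: z_def field_simps)
    also have "\<dots> = ?s ^ (n - 2) * poly ?P (z s)"
      by (simp add: prod.distrib poly_prod mult.commute)
    also have "?s * (?s ^ (n - 2) * poly ?P (z s)) = ?s ^ (n - 1) * poly ?P (z s)"
    proof -
      have "n - 1 = Suc (n - 2)" using assms(3) by simp
      then show ?thesis by simp
    qed
    finally show ?thesis using s0 by simp
  qed
  \<comment> \<open>Distinct polynomials agree at finitely many points only, whereas the points
    \<open>z s\<close> with \<open>s \<ge> n\<close> are infinitely many.\<close>
  assume "?H \<noteq> ?P"
  then have "finite {x. poly (?H - ?P) x = 0}" by (intro poly_roots_finite) simp
  moreover have "z ` {n..} \<subseteq> {x. poly (?H - ?P) x = 0}" using root by auto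
  moreover have "inj_on z {n..}"
    using assms(3) by (auto simp: inj_on_def z_def)
  ultimately have "finite {n..}"
    using finite_subset finite_imageD by blast
  then show False by (simp add: infinite_Ici)
qed

theorem theorem6p3:
  fixes n :: nat and V :: "'v set" and ord :: "('v set \<times> 'v set) set"
  assumes "n \<ge> 2"
    and "finite V" and "card V = n"
    and "linear_order_on (edges (complete_graph V)) ord"
  shows "h_polynomial (complete_graph V) ord = (\<Prod>j=1..n-2. [:1, of_nat j:])
    \<and> bc_hilbert_series TYPE('k::field) (complete_graph V) ord
        = (\<Prod>j=1..n-2. 1 + of_nat j * fps_X) / (1 - fps_X) ^ (n - 1)
    \<and> (\<forall>i\<le>n-2. coeff (h_polynomial (complete_graph V) ord) i
        = of_nat (stirling_first (n - 1) (n - 1 - i)))"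
proof -
  interpret ordered_graph "complete_graph V" ord
    by (rule ordered_graph_complete_graph) fact+
  have V: "verts (complete_graph V) = V" "V \<noteq> {}" using assms by (auto simp: complete_graph_def)
  note H = sum_BC_complete_graph[OF assms(2,3,1,4)]
  have h: "h_polynomial (complete_graph V) ord = (\<Prod>j=1..n-2. [:1, of_nat j:])"
  \<comment> \<open>The face identity is available over the rationals; comparing values at integers
    brings it back to integer polynomials, as \<open>of_int\<close> is injective.\<close>
  proof (rule poly_ext)
    fix x :: int
    have "of_int (poly (h_polynomial (complete_graph V) ord) x)
        = poly (\<Sum>F\<in>BC. [:0, 1:] ^ card F * [:1, -1:] ^ (n - 1 - card F)) (of_int x :: rat)"
      using h_polynomial_faces V assms(3) by (simp add: poly_sum)
    also have "\<dots> = of_int (poly (\<Prod>j=1..n-2. [:1, of_nat j:]) x)"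
      unfolding H by (simp add: poly_prod)
    finally show "poly (h_polynomial (complete_graph V) ord) x
        = poly (\<Prod>j=1..n-2. [:1, of_nat j:]) x"
      by (simp only: of_int_eq_iff)
  qed
  have "(\<Prod>j=1..n-2. 1 + of_nat j * fps_X) = fps_of_poly (\<Prod>j=1..n-2. [:1, of_nat j:] :: rat poly)"
    by (simp add: fps_of_poly_prod fps_of_poly_linear' fps_of_nat)
  also have "\<dots> = (\<Sum>F\<in>BC. fps_X ^ card F * (1 - fps_X) ^ (n - 1 - card F))"
    unfolding H[symmetric]
    by (simp add: fps_const_neg[symmetric] fps_of_poly_sum fps_of_poly_mult fps_of_poly_power fps_of_poly_pCons)
  also have "\<dots> = (1 - fps_X) ^ (n - 1) * bc_hilbert_series TYPE('k) (complete_graph V) ord"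
    using bc_hilbert_series_mult[where ?'k = 'k] V assms(3) by simp
  finally have hilb: "bc_hilbert_series TYPE('k) (complete_graph V) ord
      = (\<Prod>j=1..n-2. 1 + of_nat j * fps_X) / (1 - fps_X) ^ (n - 1)"
    by simp
  \<comment> \<open>This matches the closed range of the product with the half-open one of the
    coefficient formula, taken at \<open>m = n - 1\<close>.\<close>
  have "{1..n-2} = {1..<n-1}" using assms(1) by auto
  then have "coeff (h_polynomial (complete_graph V) ord) i
      = of_nat (stirling_first (n - 1) (n - 1 - i))" if "i \<le> n - 2" for i
    using that coeff_prod_stirling[of i "n - 1"] unfolding h stirling_first_eq_stirling by simp
  then show ?thesis using h hilb by blast
qed

end
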